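(* Let $p\ge5$ be prime, $k\ge1$ an integer, and $t\in\{1,\dots,p-1\}$. Let $S=\{(A,B)\in\mathbb{F}_{p^k}^2: 4A^3+27B^2\ne0\}$, and let $S_t\subset S$ be the set of pairs for which the trace $T$ of the $p^k$-th power Frobenius of the elliptic curve $y^2=x^3+Ax+B$ over $\mathbb{F}_{p^k}$ satisfies $T\equiv t\bmod p$. Then $\#S=p^{2k}-p^k$ and \[\left|\#S_t-\frac{\#S}{p-1}\right|\le 3p^{\frac{3k}{2}+1}.\]
   Context: The trace of Frobenius $T$ is the integer with $\#E(\mathbb{F}_{p^k})=p^k+1-T$. *)

theory Defs
  imports Complex_Main "HOL-Library.Cardinality" "HOL-Number_Theory.Number_Theory"
begin

text \<open>The rational points of the projective curve \<open>y\<^sup>2 = x\<^sup>3 + A x + B\<close> over the finite field \<open>'a\<close>.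
  \<open>None\<close> is the point at infinity \<open>[0 : 1 : 0]\<close>, the only point outside the affine chart.\<close>

definition ec_points :: "'a::{field,finite} \<Rightarrow> 'a \<Rightarrow> ('a \<times> 'a) option set" where
  "ec_points A B = insert None (Some ` {(x, y). y ^ 2 = x ^ 3 + A * x + B})"

definition frobenius_trace :: "'a::{field,finite} \<Rightarrow> 'a \<Rightarrow> int" where
  "frobenius_trace A B = int CARD('a) + 1 - int (card (ec_points A B))"

definition ec_pairs :: "('a::{field,finite} \<times> 'a) set" where
  "ec_pairs = {(A, B). 4 * A ^ 3 + 27 * B ^ 2 \<noteq> 0}"

definition ec_pairs_trace :: "nat \<Rightarrow> int \<Rightarrow> ('a::{field,finite} \<times> 'a) set" where
  "ec_pairs_trace p t = {(A, B) \<in> ec_pairs. [frobenius_trace A B = t] (mod int p)}"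

end

theory Submission
  imports "HOL-Algebra.Algebraic_Closure_Type" Defs
begin

text \<open>
  Write \<open>q = p\<^sup>k\<close> and \<open>p = 2 n + 1\<close>. Euler's criterion and power sums over \<open>\<bbbF>\<^sub>q\<close> show that the trace modulo \<open>p\<close>
  is the norm to \<open>\<bbbF>\<^sub>p\<close> of the Hasse invariant \<open>H(A, B)\<close>, the coefficient of \<open>x\<^sup>p\<^sup>-\<^sup>1\<close> in
  \<open>(x\<^sup>3 + A x + B)\<^sup>n\<close>. For fixed \<open>A \<noteq> 0\<close> this is a polynomial of degree at most \<open>n\<close> in \<open>B\<close>, which is squarefree
  because it satisfies the hypergeometric differential equation
  \<open>(16 A\<^sup>3 + 108 B\<^sup>2) f'' + 216 B f' + 15 f = 0\<close>; it is nonconstant for \<open>p \<ge> 7\<close>, whereas \<open>H = 2 A\<close> for \<open>p = 5\<close>.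
  Weil's bound for multiplicative character sums then equidistributes the norm of \<open>H\<close> on each slice up to
  \<open>n \<surd>q\<close>, and summing over \<open>A\<close> gives the claim.

  Weil's bound is proved by elementary means. Stepanov's method, applied over all extensions of even degree,
  bounds the character sums \<open>S\<^sub>2\<^sub>r\<close> by \<open>O(q\<^sup>r)\<close>. Newton's identities relate the \<open>S\<^sub>r\<close> to the coefficients of the
  \<open>L\<close>-polynomial, which are sums over Frobenius-invariant multisets and vanish from degree \<open>deg f\<close> on; so
  \<open>S\<^sub>r\<close> is minus the sum of the \<open>r\<close>-th powers of \<open>deg f - 1\<close> complex numbers, each of which therefore has
  absolute value at most \<open>\<surd>q\<close>.
\<close>

hide_const (open) Divisibility.prime

section \<open>Stepanov's method\<close>

text \<open>Stepanov's argument needs no derivatives here because each field has square order s^2: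
  raising x^s to the power s returns x, so the s-th powers of products of high degree agree on a
  residue class with polynomials of much lower degree, and a linear relation among the latter yields
  a nonzero polynomial of degree about s^2 / d that vanishes on the class. That is why only
  extensions of even degree are treated. They suffice, since even power sums are power sums of the
  squares of the complex numbers in question, and a bound O(q^r) for all r, whatever its constant,
  limits those squares to absolute value q. The method bounds each class only from above; a lower
  bound follows because the classes, together with the zeros of f, fill the field. All extensions
  live in one algebraic closure as fixed points of powers of Frobenius. The slice A = 0 escapes the
  squarefreeness argument, its Hasse polynomial being zero or a monomial in B. It is counted
  trivially at a cost of q, and singular pairs also cost at most q. Since n < p / 2, these
  lower-order terms fit under 3 p q^(3/2).\<close>

lemma poly_family_dependent:
  fixes P :: "'i \<Rightarrow> 'a::field poly"
  assumes "finite I" "N < card I" "\<And>i k. i \<in> I \<Longrightarrow> k \<ge> N \<Longrightarrow> coeff (P i) k = 0"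
  shows "\<exists>v. (\<exists>i\<in>I. v i \<noteq> 0) \<and> (\<Sum>i\<in>I. smult (v i) (P i)) = 0"
  using assms
proof (induction N arbitrary: P I)
  case 0
  have "P i = 0" if "i \<in> I" for i
    using "0.prems"(3)[OF that] by (intro poly_eqI) auto
  moreover obtain i where "i \<in> I" using "0.prems"(2) by (metis card.empty equals0I less_irrefl)
  ultimately show ?case by (intro exI[of _ "\<lambda>_. 1"]) auto
next
  case (Suc N)
  show ?case
  proof (cases "\<forall>i\<in>I. coeff (P i) N = 0")
    case True
    have "coeff (P i) k = 0" if "i \<in> I" "k \<ge> N" for i k
      using Suc.prems(3)[of i k] True that by (cases "k = N") auto
    then show ?thesis
      using Suc.IH[of I P] Suc.prems by auto
  next
    case False
    then obtain i0 where i0: "i0 \<in> I" "coeff (P i0) N \<noteq> 0" by blast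
    define c where "c i = coeff (P i) N / coeff (P i0) N" for i
    define P' where "P' i = P i - smult (c i) (P i0)" for i
    define I' where "I' = I - {i0}"
    have fin: "finite I'" and card: "N < card I'" 
      using Suc.prems i0 by (auto simp: I'_def)
    have "coeff (P' i) k = 0" if "i \<in> I'" "k \<ge> N" for i k
    proof (cases "k = N")
      case True
      then show ?thesis using i0 by (simp add: P'_def c_def)
    next
      case False
      then have "coeff (P i) k = 0" "coeff (P i0) k = 0"
        using that Suc.prems(3) i0 by (auto simp: I'_def)
      then show ?thesis by (simp add: P'_def)
    qed
    then obtain v where v: "\<exists>i\<in>I'. v i \<noteq> 0" "(\<Sum>i\<in>I'. smult (v i) (P' i)) = 0"
      using Suc.IH[OF fin card, of P'] by blast
    define w where "w i = (if i = i0 then - (\<Sum>i\<in>I'. v i * c i) else v i)" for i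
    have "(\<Sum>i\<in>I. smult (w i) (P i)) = smult (w i0) (P i0) + (\<Sum>i\<in>I'. smult (w i) (P i))"
      unfolding I'_def using Suc.prems(1) i0 by (subst sum.remove[of I i0]) auto
    also have "(\<Sum>i\<in>I'. smult (w i) (P i)) = (\<Sum>i\<in>I'. smult (v i) (P i))"
      by (intro sum.cong) (auto simp: w_def I'_def)
    also have "smult (w i0) (P i0) + \<dots> = (\<Sum>i\<in>I'. smult (v i) (P' i))"
      by (simp add: w_def P'_def smult_diff_right sum_subtractf smult_sum)
    finally have "(\<Sum>i\<in>I. smult (w i) (P i)) = 0" using v by simp
    moreover have "\<exists>i\<in>I. w i \<noteq> 0"
      using v(1) by (auto simp: w_def I'_def)
    ultimately show ?thesis by blast
  qed
qed

text \<open>The term of least order at \<open>a\<close> among those with nonzero coefficient cannot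
  cancel: since the orders are distinct, all other terms are divisible by a higher power of X -
  a.\<close>

lemma sum_neq_0_of_distinct_orders:
  fixes P :: "'i \<Rightarrow> 'a::field poly"
  assumes "finite I" and nz: "\<And>i. i \<in> I \<Longrightarrow> P i \<noteq> 0"
    and inj: "inj_on (\<lambda>i. order a (P i)) I" and v: "\<exists>i\<in>I. v i \<noteq> 0"
  shows "(\<Sum>i\<in>I. smult (v i) (P i)) \<noteq> 0"
proof
  assume eq: "(\<Sum>i\<in>I. smult (v i) (P i)) = 0"
  define I' where "I' = {i\<in>I. v i \<noteq> 0}"
  have I': "finite I'" "I' \<noteq> {}" using assms by (auto simp: I'_def)
  define i0 where "i0 = arg_min_on (\<lambda>i. order a (P i)) I'"
  have i0: "i0 \<in> I'" unfolding i0_def using I' by (intro arg_min_if_finite)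
  have less: "order a (P i0) < order a (P i)" if "i \<in> I'" "i \<noteq> i0" for i
  proof -
    have "order a (P i0) \<le> order a (P i)"
      unfolding i0_def using I' that by (intro arg_min_least) auto
    moreover have "order a (P i0) \<noteq> order a (P i)"
      using inj that i0 by (auto simp: inj_on_def I'_def)
    ultimately show ?thesis by simp
  qed
  have "(\<Sum>i\<in>I. smult (v i) (P i)) = (\<Sum>i\<in>I'. smult (v i) (P i))"
    using assms(1) by (intro sum.mono_neutral_right) (auto simp: I'_def)
  also have "\<dots> = smult (v i0) (P i0) + (\<Sum>i\<in>I'-{i0}. smult (v i) (P i))"
    using I' i0 by (subst sum.remove[of I' i0]) auto
  finally have "smult (v i0) (P i0) = - (\<Sum>i\<in>I'-{i0}. smult (v i) (P i))"
    using eq by (simp add: add_eq_0_iff2)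
  moreover have "[:-a, 1:] ^ Suc (order a (P i0)) dvd (\<Sum>i\<in>I'-{i0}. smult (v i) (P i))"
    using less by (intro dvd_sum dvd_smult) (auto simp: order_divides Suc_le_eq simp del: power_Suc)
  ultimately have "[:-a, 1:] ^ Suc (order a (P i0)) dvd smult (v i0) (P i0)"
    by simp
  then have "[:-a, 1:] ^ Suc (order a (P i0)) dvd P i0"
    using i0 by (simp add: I'_def dvd_smult_iff)
  moreover have "P i0 \<noteq> 0" using i0 nz by (auto simp: I'_def)
  ultimately show False by (simp add: order_divides del: power_Suc)
qed

lemma order_power: "f \<noteq> 0 \<Longrightarrow> order a (f ^ n) = n * order a (f :: 'a::idom poly)"
  by (induction n) (auto simp: order_mult)

lemma stepanov_bound:
  fixes f :: "'a::alg_closed_field poly"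
  assumes char: "prime CHAR('a)" "s = CHAR('a) ^ e" and s: "s \<ge> 3"
    and d: "d dvd s - 1" and f0: "f \<noteq> 0" and f: "order \<alpha> f = 1"
  defines "m \<equiv> degree f"
  shows "d * card {x. x ^ (s ^ 2) = x \<and> poly f x ^ ((s ^ 2 - 1) div d) = \<zeta>}
           \<le> s ^ 2 + d * (4 * m + 6) * s" (is "d * card ?X \<le> _")
proof -
  define D where "D = (s - 1) div d"
  \<comment> \<open>The number (s - 1) J of unknowns has to exceed \<open>N\<close>, which means J >
    s (D + m) / (s - 2). As s \<ge> 3 and D < s, the summand 3 m + 5 achieves this.\<close>
  define J where "J = D + 3 * m + 5"
  define I where "I = {..<s-1} \<times> {..<J}"
  define N where "N = s * D + s * m + J"
  define \<beta> where "\<beta> = \<alpha> ^ (s ^ 2)"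
  txt \<open>The auxiliary polynomial is a linear combination \<open>W\<close> of the \<open>R (n, j)\<close>, whose orders at \<open>\<alpha>\<close> are
    distinct. On \<open>?X\<close> the \<open>s\<close>-th powers of the \<open>R (n, j)\<close> agree with the polynomials \<open>P (n, j)\<close> of much smaller
    degree, and the latter satisfy a nontrivial linear relation, so that \<open>W\<close> vanishes on \<open>?X\<close>.\<close>
  define P where "P = (\<lambda>(n, j). smult (\<zeta> ^ (n div D))
     ([:-\<alpha>, 1:] ^ (s * (n mod D)) * f ^ (s - D * (n div D)) * [:-\<beta>, 1:] ^ j))"
  define R where "R = (\<lambda>(n, j). [:-\<alpha>, 1:] ^ (n mod D + s * j) * f ^ (D * (n div D) + 1))"
  have dD: "d * D = s - 1" using d by (simp add: D_def)
  have [simp]: "d > 0" "D > 0" using dD s by (auto intro!: Nat.gr0I)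
  have D_le: "D \<le> s - 1" using dD by (metis \<open>d > 0\<close> dvd_imp_le dvd_triv_right s
     One_nat_def Suc_le_eq diff_is_0_eq neq0_conv not_less_eq_eq numeral_3_eq_3 mult_is_0 neq0_conv)
  note f0 [simp]
  have ndiv: "n div D < d" if "n < s - 1" for n
    using that dD by (simp add: less_mult_imp_div_less)
  have nD: "D * (n div D) \<le> s - 1" if "n < s - 1" for n
    using that by (meson le_less_trans less_imp_le_nat times_div_less_eq_dividend)
  have degP: "coeff (P i) k = 0" if "i \<in> I" "k \<ge> N" for i k
  proof -
    obtain n j where [simp]: "i = (n, j)" by force
    have nj: "n < s - 1" "j < J" using that by (auto simp: I_def)
    have "degree (P i) \<le> degree ([:-\<alpha>, 1:] ^ (s * (n mod D)) * f ^ (s - D * (n div D)) * [:-\<beta>, 1:] ^ j)"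
      by (simp add: P_def degree_smult_le)
    also have "\<dots> = s * (n mod D) + (s - D * (n div D)) * m + j"
      by (simp add: degree_mult_eq degree_power_eq m_def)
    also have "\<dots> \<le> s * D + s * m + j"
      using nj by (intro add_mono mult_mono) (auto simp: less_imp_le)
    also have "\<dots> < N" using nj by (simp add: N_def)
    finally show ?thesis using that by (intro coeff_eq_0) simp
  qed
  have "N < card I"
  proof -
    obtain s' where s': "s = s' + 3" using s by (metis add.commute le_Suc_ex)
    have "D \<le> s' + 2" using D_le s' by simp
    then have "s * D + s * m + J < (s - 1) * J"
      unfolding J_def s' by (simp add: algebra_simps)
    then show ?thesis by (simp add: N_def I_def card_cartesian_product)
  qed
  moreover have "finite I" by (simp add: I_def)
  ultimately obtain v where v: "\<exists>i\<in>I. v i \<noteq> 0" "(\<Sum>i\<in>I. smult (v i) (P i)) = 0"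
    using poly_family_dependent[of I N P] degP by blast
  \<comment> \<open>Raising to the power s is only semilinear, so the relation among the
    \<open>P i\<close> is pulled back through s-th roots of its coefficients.\<close>
  have "\<exists>y. y ^ s = v i" for i using s by (intro nth_root_exists) auto
  then obtain u where u: "\<And>i. u i ^ s = v i" by metis
  define W where "W = (\<Sum>i\<in>I. smult (u i) (R i))"
  have R_nz: "R i \<noteq> 0" for i by (auto simp: R_def split: prod.splits)
  \<comment> \<open>As n + 1 < s on \<open>I\<close>, the numbers n + 1 and j are the base-s digits
    of this order; hence the orders are distinct.\<close>
  have ordR: "order \<alpha> (R (n, j)) = n + 1 + s * j" for n j
  proof -
    have "order \<alpha> (R (n, j)) = (n mod D + s * j) + (D * (n div D) + 1)"
      unfolding R_def using f by (simp add: order_mult order_power order_power_n_n del: power_Suc)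
    then show ?thesis by (simp add: algebra_simps) 
  qed
  have "inj_on (\<lambda>i. order \<alpha> (R i)) I"
  proof (rule inj_onI, clarify)
    fix n j n' j' assume "(n, j) \<in> I" "(n', j') \<in> I" and eq: "order \<alpha> (R (n, j)) = order \<alpha> (R (n', j'))"
    then have lt: "n + 1 < s" "n' + 1 < s" by (auto simp: I_def)
    have eq: "n + 1 + s * j = n' + 1 + s * j'" using eq by (simp add: ordR)
    then have "(n + 1 + s * j) mod s = (n' + 1 + s * j') mod s" by simp
    then have "n = n'" using lt by simp
    then show "n = n' \<and> j = j'" using eq s by simp
  qed
  moreover have "\<exists>i\<in>I. u i \<noteq> 0" 
    using v(1) s by (metis u neq0_conv power_0_left not_numeral_le_zero)
  ultimately have W_nz: "W \<noteq> 0"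
    unfolding W_def using \<open>finite I\<close> R_nz by (intro sum_neq_0_of_distinct_orders[where a = \<alpha>]) auto
  have root: "poly W x = 0" if x: "x \<in> ?X" for x
  proof -
    have Q: "s ^ 2 - 1 = (s - 1) * (s + 1)" by (simp add: power2_eq_square algebra_simps)
    have "(s ^ 2 - 1) div d = D * (s + 1)"
      unfolding Q using d by (simp add: D_def div_mult_swap mult.commute)
    then have z: "poly f x ^ (D * (s + 1)) = \<zeta>" and xx: "x ^ (s ^ 2) = x" using x by auto
    have trm: "poly (R (n, j)) x ^ s = poly (P (n, j)) x" if "(n, j) \<in> I" for n j
    proof -
      have n: "n < s - 1" using that by (auto simp: I_def)
      have "(x - \<alpha>) ^ (s ^ 2) = x ^ (s ^ 2) - \<alpha> ^ (s ^ 2)"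
        using freshmans_dream'[of "s ^ 2" "2 * e" "x - \<alpha>" \<alpha>] char
        by (simp add: power_mult[symmetric] mult.commute eq_diff_eq)
      then have b: "(x - \<alpha>) ^ (s ^ 2) = x - \<beta>" by (simp add: xx \<beta>_def)
      have "((x - \<alpha>) ^ (s * j)) ^ s = ((x - \<alpha>) ^ (s ^ 2)) ^ j"
        by (simp add: power_mult[symmetric] power2_eq_square mult_ac)
      then have 1: "((x - \<alpha>) ^ (s * j)) ^ s = (x - \<beta>) ^ j" by (simp add: b)
      have "(poly f x ^ (D * (n div D) + 1)) ^ s = poly f x ^ ((D * (n div D) + 1) * s)"
        by (simp only: power_mult)
      \<comment> \<open>Each block D (s + 1) of the exponent turns into a factor \<zeta>. The single
        extra factor \<open>f\<close> in \<open>R\<close> keeps the remaining exponent positive,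
        because D (n div D) < s.\<close>
      also have "(D * (n div D) + 1) * s = D * (s + 1) * (n div D) + (s - D * (n div D))"
        using nD[OF n] by (simp add: algebra_simps)
      also have "poly f x ^ \<dots> = \<zeta> ^ (n div D) * poly f x ^ (s - D * (n div D))"
        by (simp only: power_add power_mult[of _ "D * (s + 1)"] z)
      finally have 2: "(poly f x ^ (D * (n div D) + 1)) ^ s = \<dots>" .
      show ?thesis
        unfolding R_def P_def prod.case poly_mult poly_power poly_smult power_mult_distrib 2
          power_add[of _ _ "s * j"] 
        using 1 by (simp add: power_mult[symmetric] mult_ac)
    qed
    have "poly W x ^ s = (\<Sum>i\<in>I. (u i * poly (R i) x) ^ s)"
      unfolding W_def poly_sum poly_smult using char by (rule freshmans_dream_sum')
    also have "\<dots> = (\<Sum>i\<in>I. v i * poly (P i) x)"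
      by (intro sum.cong refl) (auto simp: power_mult_distrib u trm)
    also have "\<dots> = poly (\<Sum>i\<in>I. smult (v i) (P i)) x" by (simp add: poly_sum)
    finally show ?thesis using v(2) s by simp
  qed
  have "card ?X \<le> card {x. poly W x = 0}"
    using W_nz root by (intro card_mono poly_roots_finite) auto
  also have "\<dots> \<le> degree W" using W_nz by (rule card_poly_roots_bound)
  also have "degree W \<le> D + s * J + s * m"
    unfolding W_def
  proof (intro degree_sum_le \<open>finite I\<close>)
    fix i assume "i \<in> I"
    then obtain n j where nj: "i = (n, j)" "n < s - 1" "j < J" by (auto simp: I_def)
    have "degree (smult (u i) (R i)) \<le> degree (R i)" by (rule degree_smult_le)
    also have "\<dots> = (n mod D + s * j) + (D * (n div D) + 1) * m"
      unfolding nj R_def by (simp add: degree_mult_eq degree_power_eq m_def del: power_Suc)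
    also have "\<dots> \<le> (D + s * J) + s * m"
      using nj nD[of n] s by (intro add_mono mult_mono) (auto simp: less_imp_le)
    finally show "degree (smult (u i) (R i)) \<le> D + s * J + s * m" by simp
  qed
  \<comment> \<open>With d D = s - 1 the leading part of this bound is (s - 1) + s (s - 1) = s^2 -
    1; everything else is linear in s.\<close>
  finally have "d * card ?X \<le> d * (D + s * J + s * m)" by simp
  also have "\<dots> = d * D + s * (d * D) + d * s * (4 * m + 5)"
    by (simp add: J_def algebra_simps)
  also have "\<dots> \<le> s ^ 2 + d * (4 * m + 6) * s"
    unfolding dD using s by (cases s) (auto simp: algebra_simps power2_eq_square)
  finally show ?thesis .
qed

section \<open>Multisets invariant under an injection\<close>

text \<open>For a point with \<open>(\<phi> ^^ r) x = x\<close> these are its conjugates in degree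
  r: the orbit of \<open>x\<close>, repeated as often as its length divides r.\<close>

definition cycle_mset :: "('a \<Rightarrow> 'a) \<Rightarrow> nat \<Rightarrow> 'a \<Rightarrow> 'a multiset" where
  "cycle_mset \<phi> r x = image_mset (\<lambda>i. (\<phi> ^^ i) x) (mset_set {..<r})"

lemma size_cycle_mset [simp]: "size (cycle_mset \<phi> r x) = r"
  by (simp add: cycle_mset_def)

lemma cycle_mset_0 [simp]: "cycle_mset \<phi> 0 x = {#}"
  by (simp add: cycle_mset_def)

lemma cycle_mset_Suc: "cycle_mset \<phi> (Suc r) x = add_mset ((\<phi> ^^ r) x) (cycle_mset \<phi> r x)"
  by (simp add: cycle_mset_def lessThan_Suc)

lemma cycle_mset_add: "cycle_mset \<phi> (k + r) x = cycle_mset \<phi> k x + cycle_mset \<phi> r ((\<phi> ^^ k) x)"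
proof (induction r)
  case (Suc r)
  have "(\<phi> ^^ (k + r)) x = (\<phi> ^^ r) ((\<phi> ^^ k) x)"
    by (subst add.commute) (simp add: funpow_add)
  then show ?case using Suc by (simp add: cycle_mset_Suc)
qed simp

lemma image_cycle_mset:
  assumes "(\<phi> ^^ r) x = x"
  shows "image_mset \<phi> (cycle_mset \<phi> r x) = cycle_mset \<phi> r x"
proof -
  have "add_mset x (image_mset \<phi> (cycle_mset \<phi> r x)) = add_mset ((\<phi> ^^ r) x) (cycle_mset \<phi> r x)"
    by (induction r) (auto simp: cycle_mset_Suc)
  then show ?thesis using assms by simp
qed

lemma funpow_inj_cancel: "inj \<phi> \<Longrightarrow> (\<phi> ^^ (i + k)) x = (\<phi> ^^ i) x \<Longrightarrow> (\<phi> ^^ k) x = x"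
  by (metis comp_apply funpow_add injD inj_fn)

text \<open>Let k be the period of a point \<open>x\<close> of \<open>Z\<close>. The admissible r
  are multiples j k, and the cycle of length j k consists of j copies of the orbit, so it fits into
  the invariant multiset \<open>Z\<close> exactly when j is at most the multiplicity of
  \<open>x\<close>. The induction removes one orbit at a time.\<close>

lemma card_cycles_eq_count:
  assumes "inj \<phi>" "image_mset \<phi> Z = Z"
  shows "card {r. 1 \<le> r \<and> (\<phi> ^^ r) x = x \<and> cycle_mset \<phi> r x \<subseteq># Z} = count Z x"
    and "finite {r. 1 \<le> r \<and> (\<phi> ^^ r) x = x \<and> cycle_mset \<phi> r x \<subseteq># Z}"
proof -
  define R where "R Z = {r. 1 \<le> r \<and> (\<phi> ^^ r) x = x \<and> cycle_mset \<phi> r x \<subseteq># Z}" for Z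
  have "card (R Z) = count Z x \<and> finite (R Z)" using assms(2)
  proof (induction "size Z" arbitrary: Z rule: less_induct)
    case less
    show ?case
    proof (cases "x \<in># Z")
      case False
      have "x \<in># cycle_mset \<phi> r x" if "1 \<le> r" for r
        using that by (auto simp: cycle_mset_def intro!: image_eqI[of _ _ 0])
      then have "R Z = {}" using False by (auto simp: R_def dest: mset_subset_eqD)
      then show ?thesis using False by (simp add: not_in_iff)
    next
      case True
      have inX: "(\<phi> ^^ i) x \<in># Z" for i
      proof (induction i)
        case (Suc i)
        then have "\<phi> ((\<phi> ^^ i) x) \<in># image_mset \<phi> Z" by simp
        then show ?case using less.prems by simp
      qed (use True in simp)
      have "\<not> inj (\<lambda>i. (\<phi> ^^ i) x)"
        using inX by (meson finite_set_mset finite_subset image_subsetI infinite_UNIV_nat finite_imageD)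
      then obtain i j where "i < j" "(\<phi> ^^ i) x = (\<phi> ^^ j) x"
        unfolding inj_def by (metis linorder_neqE_nat)
      then have "(\<phi> ^^ (j - i)) x = x"
        using funpow_inj_cancel[OF assms(1), of i "j - i" x] by simp
      then have ex: "\<exists>r. 1 \<le> r \<and> (\<phi> ^^ r) x = x" using \<open>i < j\<close> by (intro exI[of _ "j - i"]) auto
      define k where "k = (LEAST r. 1 \<le> r \<and> (\<phi> ^^ r) x = x)"
      have k: "1 \<le> k" "(\<phi> ^^ k) x = x" using LeastI_ex[OF ex] by (auto simp: k_def)
      have k_le: "k \<le> r" if "1 \<le> r" "(\<phi> ^^ r) x = x" for r
        unfolding k_def using that by (intro Least_le) auto
      have "inj_on (\<lambda>i. (\<phi> ^^ i) x) {..<k}"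
      proof (rule linorder_inj_onI)
        fix i j assume "i < j" "i \<in> {..<k}" "j \<in> {..<k}"
        then have "(\<phi> ^^ (j - i)) x \<noteq> x"
          using k_le[of "j - i"] by fastforce
        then show "(\<phi> ^^ i) x \<noteq> (\<phi> ^^ j) x"
          using funpow_inj_cancel[OF assms(1), of i "j - i" x] \<open>i < j\<close> by auto
      qed auto
      then have "cycle_mset \<phi> k x = mset_set ((\<lambda>i. (\<phi> ^^ i) x) ` {..<k})"
        by (simp add: cycle_mset_def image_mset_mset_set)
      moreover have le: "mset_set A \<subseteq># Z" if "finite A" "\<And>a. a \<in> A \<Longrightarrow> a \<in># Z" for A
        using that by (intro mset_subset_eqI) (auto simp: count_mset_set' Suc_le_eq)
      moreover have "mset_set ((\<lambda>i. (\<phi> ^^ i) x) ` {..<k}) \<subseteq># Z"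
        by (rule le) (use inX in auto)
      ultimately have sub: "cycle_mset \<phi> k x \<subseteq># Z" by simp
      define Y where "Y = Z - cycle_mset \<phi> k x"
      have Z: "Z = cycle_mset \<phi> k x + Y" using sub by (simp add: Y_def)
      have "image_mset \<phi> Y = Y"
        using less.prems image_cycle_mset[OF k(2)] by (subst (asm) (1 2) Z) simp
      moreover have "size Y < size Z" using k by (subst Z) simp
      ultimately have IH: "card (R Y) = count Y x" "finite (R Y)" using less.hyps by auto
      have RX: "R Z = insert k ((+) k ` R Y)"
      proof (intro equalityI subsetI)
        fix r assume r: "r \<in> R Z"
        then have "k \<le> r" using k_le by (auto simp: R_def)
        show "r \<in> insert k ((+) k ` R Y)"
        proof (cases "r = k")
          case False
          then obtain r' where r': "r = k + r'" "1 \<le> r'" using \<open>k \<le> r\<close>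
            by (metis add_diff_inverse_nat diff_is_0_eq le_antisym less_one linorder_not_less)
          have "(\<phi> ^^ r') x = x"
            using r k(2) unfolding r' R_def by (subst (asm) add.commute) (simp add: funpow_add)
          moreover have "cycle_mset \<phi> r' x \<subseteq># Y"
            using r unfolding r' R_def by (simp add: cycle_mset_add k Z)
          ultimately show ?thesis using r' by (auto simp: R_def)
        qed simp
      next
        fix r assume "r \<in> insert k ((+) k ` R Y)"
        then consider "r = k" | r' where "r = k + r'" "r' \<in> R Y" by blast
        then show "r \<in> R Z"
        proof cases
          case 1
          then show ?thesis using k sub by (simp add: R_def)
        next
          case 2
          have "(\<phi> ^^ (r' + k)) x = x" using 2 k by (simp add: R_def funpow_add)
          then show ?thesis using 2 k by (simp add: R_def Z cycle_mset_add add.commute)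
        qed
      qed
      have "k \<notin> (+) k ` R Y" by (auto simp: R_def)
      then have "card (R Z) = Suc (count Y x)"
        using IH by (simp add: RX card_image)
      moreover have "count (cycle_mset \<phi> k x) x = 1"
        unfolding \<open>cycle_mset \<phi> k x = mset_set _\<close> using k
        by (auto simp: count_mset_set' intro!: image_eqI[of _ _ 0])
      ultimately show ?thesis using IH by (simp add: RX) (simp add: Z)
    qed
  qed
  then show "card {r. 1 \<le> r \<and> (\<phi> ^^ r) x = x \<and> cycle_mset \<phi> r x \<subseteq># Z} = count Z x"
    "finite {r. 1 \<le> r \<and> (\<phi> ^^ r) x = x \<and> cycle_mset \<phi> r x \<subseteq># Z}" by (auto simp: R_def)
qed

text \<open>Double counting: an invariant multiset of size n contains exactly n pairs (x, r) whose
  cycle lies inside it, by summing multiplicities. Splitting off the cycle leaves an invariant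
  multiset of size n - r. This is the coefficient form of the logarithmic derivative of an Euler
  product, obtained without the product.\<close>

lemma newton_identity_invariant_msets:
  fixes w :: "'a multiset \<Rightarrow> 'b::comm_ring_1" and \<phi> :: "'a \<Rightarrow> 'a"
  defines "M \<equiv> (\<lambda>n. {Z. size Z = n \<and> image_mset \<phi> Z = Z})"
  assumes "inj \<phi>" and finM: "\<And>n. finite (M n)" and finK: "\<And>r. r \<ge> 1 \<Longrightarrow> finite {x. (\<phi> ^^ r) x = x}"
    and w: "\<And>Z Y. image_mset \<phi> Z = Z \<Longrightarrow> image_mset \<phi> Y = Y \<Longrightarrow> w (Z + Y) = w Z * w Y"
  shows "of_nat n * (\<Sum>Z\<in>M n. w Z) =
    (\<Sum>r=1..n. (\<Sum>x | (\<phi> ^^ r) x = x. w (cycle_mset \<phi> r x)) * (\<Sum>Y\<in>M (n - r). w Y))"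
proof -
  define R where "R Z x = {r. 1 \<le> r \<and> (\<phi> ^^ r) x = x \<and> cycle_mset \<phi> r x \<subseteq># Z}" for Z x
  define S where "S Z = (SIGMA x:set_mset Z. R Z x)" for Z
  have R: "card (R Z x) = count Z x" "finite (R Z x)" if "image_mset \<phi> Z = Z" for Z x
    using card_cycles_eq_count[OF \<open>inj \<phi>\<close> that] by (auto simp: R_def)
  have S: "card (S Z) = n" "finite (S Z)" if "Z \<in> M n" for Z
    using that R[of Z] unfolding S_def M_def
    by (auto simp: size_multiset_overloaded_eq intro!: finite_SigmaI)
  have "of_nat n * (\<Sum>Z\<in>M n. w Z) = (\<Sum>Z\<in>M n. \<Sum>z\<in>S Z. w Z)"
    using S by (simp add: sum_distrib_left)
  also have "\<dots> = (\<Sum>(Z, z)\<in>Sigma (M n) S. w Z)"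
    using S finM by (intro sum.Sigma) auto
  also have "\<dots> = (\<Sum>(r, x, Y)\<in>(SIGMA r:{1..n}. SIGMA x:{x. (\<phi> ^^ r) x = x}. M (n - r)). w (cycle_mset \<phi> r x) * w Y)"
  proof (rule sum.reindex_bij_witness[where
        i = "\<lambda>(r, x, Y). (cycle_mset \<phi> r x + Y, (x, r))" and
        j = "\<lambda>(Z, (x, r)). (r, x, Z - cycle_mset \<phi> r x)"], goal_cases)
    case (1 a)
    then show ?case by (auto simp: S_def R_def)
  next
    case (2 a)
    then obtain Z x r where a: "a = (Z, (x, r))" "Z \<in> M n" "1 \<le> r" "(\<phi> ^^ r) x = x" "cycle_mset \<phi> r x \<subseteq># Z"
      by (auto simp: S_def R_def)
    then have "r \<le> n" using size_mset_mono[OF a(5)] by (simp add: M_def)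
    then show ?case using a
      by (auto simp: M_def size_Diff_submset image_mset_Diff image_cycle_mset)
  next
    case (3 b)
    then show ?case by auto
  next
    case (4 b)
    then obtain r x Y where b: "b = (r, x, Y)" "1 \<le> r" "r \<le> n" "(\<phi> ^^ r) x = x" "Y \<in> M (n - r)" by auto
    have "x \<in># cycle_mset \<phi> r x" using b(2) by (auto simp: cycle_mset_def intro!: image_eqI[of _ _ 0])
    then show ?case using b by (auto simp: M_def S_def R_def image_cycle_mset)
  next
    case (5 a)
    then obtain Z x r where a: "a = (Z, (x, r))" "Z \<in> M n" "1 \<le> r" "(\<phi> ^^ r) x = x" "cycle_mset \<phi> r x \<subseteq># Z"
      by (auto simp: S_def R_def)
    have "w (cycle_mset \<phi> r x + (Z - cycle_mset \<phi> r x)) = w (cycle_mset \<phi> r x) * w (Z - cycle_mset \<phi> r x)"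
      using a by (intro w) (auto simp: M_def image_mset_Diff image_cycle_mset)
    then show ?case using a by simp
  qed
  also have "\<dots> = (\<Sum>r=1..n. \<Sum>x | (\<phi> ^^ r) x = x. \<Sum>Y\<in>M (n - r). w (cycle_mset \<phi> r x) * w Y)"
    using finM finK by (subst sum.Sigma[symmetric]; (intro sum.cong refl)?; (subst sum.Sigma[symmetric])?)
      (auto intro!: finite_SigmaI)
  also have "\<dots> = (\<Sum>r=1..n. (\<Sum>x | (\<phi> ^^ r) x = x. w (cycle_mset \<phi> r x)) * (\<Sum>Y\<in>M (n - r). w Y))"
    by (simp add: sum_product)
  finally show ?thesis .
qed

section \<open>Newton's identities and power sums\<close>

text \<open>The \<open>w i\<close> are the reciprocals of the roots, padded with zeros when the
  degree is below \<open>k\<close>; this keeps the number of factors fixed.\<close>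

lemma poly_factor_inverse_roots:
  fixes p :: "complex poly"
  assumes "coeff p 0 = 1" "degree p \<le> k"
  shows "\<exists>w. p = (\<Prod>i<k. [:1, - w i:])"
  using assms
proof (induction k arbitrary: p)
  case 0
  then have "p = 1" by (metis degree_eq_zeroE coeff_pCons_0 le_zero_eq one_pCons)
  then show ?case by simp
next
  case (Suc k)
  show ?case
  proof (cases "degree p = 0")
    case True
    then have "p = 1" using Suc.prems(1) by (metis degree_eq_zeroE coeff_pCons_0 one_pCons)
    then show ?thesis by (intro exI[of _ "\<lambda>_. 0"]) (simp add: one_pCons[symmetric])
  next
    case False
    then obtain x where x: "poly p x = 0" using alg_closed_imp_poly_has_root by blast
    then obtain q where q: "p = [:-x, 1:] * q" unfolding poly_eq_0_iff_dvd by blast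
    have x0: "x \<noteq> 0" "coeff q 0 * (- x) = 1" using Suc.prems(1) by (auto simp: q mult.commute[of "coeff q 0"])
    have p: "p = [:1, - (1 / x):] * smult (- x) q" using x0 by (simp add: q field_simps)
    have "degree (smult (- x) q) \<le> k"
      using x0 Suc.prems(2) unfolding p by (subst (asm) degree_mult_eq) auto
    moreover have "coeff (smult (- x) q) 0 = 1" by (simp only: coeff_smult mult.commute[of "- x"] x0)
    ultimately obtain w where w: "smult (- x) q = (\<Prod>i<k. [:1, - w i:])"
      using Suc.IH[of "smult (- x) q"] by blast
    have "(\<Prod>i<Suc k. [:1, - (w(k := 1 / x)) i:]) = [:1, - (1 / x):] * (\<Prod>i<k. [:1, - w i:])"
      unfolding prod.lessThan_Suc by (subst mult.commute, intro arg_cong2[where f = "(*)"] prod.cong) auto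
    also have "\<dots> = p" unfolding w[symmetric] by (rule p[symmetric])
    finally have "p = (\<Prod>i<Suc k. [:1, - (w(k := 1 / x)) i:])" ..
    then show ?thesis by blast
  qed
qed

text \<open>Read as power series, the recurrence says T F = X F', where F generates \<open>a\<close>
  and T generates \<open>S\<close>. The factorization of F gives the same equation with T replaced
  by minus the sum of the geometric series of the \<open>w i\<close>, and F can be
  cancelled.\<close>

lemma newton_power_sums:
  fixes a S :: "nat \<Rightarrow> complex"
  assumes a: "a 0 = 1" "\<And>n. n > k \<Longrightarrow> a n = 0"
    and newton: "\<And>n. of_nat n * a n = (\<Sum>r=1..n. S r * a (n - r))"
  shows "\<exists>w. \<forall>r\<ge>1. S r = - (\<Sum>i<k. w i ^ r)"
proof -
  define p where "p = (\<Sum>n\<le>k. monom (a n) n)"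
  have coeff_p: "coeff p n = a n" for n
    using a(2)[of n] by (simp add: p_def coeff_sum)
  have "degree p \<le> k" unfolding p_def
    by (intro degree_sum_le) (auto intro: order_trans[OF degree_monom_le])
  then obtain w where w: "p = (\<Prod>i<k. [:1, - w i:])"
    using poly_factor_inverse_roots[of p k] a coeff_p by metis
  define F where "F k = (\<Prod>i<k. 1 - fps_const (w i) * fps_X)" for k
  define g where "g c = Abs_fps (\<lambda>r. if r = 0 then 0 else c ^ r)" for c :: complex
  have g: "g c * (1 - fps_const c * fps_X) = fps_const c * fps_X" for c
  proof (rule fps_ext)
    fix n
    have "g c * (1 - fps_const c * fps_X) = g c - fps_const c * (fps_X * g c)"
      by (simp add: algebra_simps)
    then show "fps_nth (g c * (1 - fps_const c * fps_X)) n = fps_nth (fps_const c * fps_X) n"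
      by (cases n) (auto simp: g_def fps_X_nth)
  qed
  have deriv: "fps_X * fps_deriv (F k) = - (\<Sum>i<k. g (w i)) * F k" for k
  proof (induction k)
    case (Suc k)
    have F: "F (Suc k) = F k * (1 - fps_const (w k) * fps_X)" by (simp add: F_def)
    have "fps_X * fps_deriv (F (Suc k)) =
        (fps_X * fps_deriv (F k)) * (1 - fps_const (w k) * fps_X) - (fps_const (w k) * fps_X) * F k"
      by (simp add: F algebra_simps)
    also have "\<dots> = - (\<Sum>i<k. g (w i)) * F (Suc k) - g (w k) * F (Suc k)"
      unfolding Suc by (subst g[symmetric]) (simp only: F mult_ac)
    finally show ?case by (simp only: sum.lessThan_Suc ring_distribs minus_add_distrib mult_minus_left) simp
  qed (simp add: F_def)
  have "fps_of_poly p = F k"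
    unfolding w F_def fps_of_poly_prod
    by (intro prod.cong refl) (simp add: fps_of_poly_pCons mult.commute)
  moreover have "fps_of_poly p = Abs_fps a" by (intro fps_ext) (simp add: coeff_p)
  ultimately have F: "F k = Abs_fps a" by simp
  define T where "T = Abs_fps (\<lambda>r. if r = 0 then 0 else S r)"
  have "T * F k = fps_X * fps_deriv (F k)"
  proof (rule fps_ext)
    fix n
    have "fps_nth (T * F k) n = (\<Sum>r=0..n. (if r = 0 then 0 else S r) * a (n - r))"
      by (simp add: fps_mult_nth F T_def)
    also have "\<dots> = (\<Sum>r=1..n. S r * a (n - r))"
      by (intro sum.mono_neutral_cong_right) auto
    also have "\<dots> = of_nat n * a n" by (simp add: newton)
    also have "\<dots> = fps_nth (fps_X * fps_deriv (F k)) n"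
      by (cases n) (auto simp: F)
    finally show "fps_nth (T * F k) n = fps_nth (fps_X * fps_deriv (F k)) n" .
  qed
  then have "T * F k = - (\<Sum>i<k. g (w i)) * F k"
    using deriv[of k] by (rule trans)
  moreover have "F k \<noteq> 0" using F a(1) by (metis fps_nth_Abs_fps fps_zero_nth zero_neq_one)
  ultimately have T: "T = - (\<Sum>i<k. g (w i))"
    using mult_right_cancel[of "F k" T "- (\<Sum>i<k. g (w i))"] by blast
  have "S r = - (\<Sum>i<k. w i ^ r)" if "r \<ge> 1" for r
  proof -
    have "S r = fps_nth T r" using that by (simp add: T_def)
    also have "\<dots> = - (\<Sum>i<k. fps_nth (g (w i)) r)" by (simp add: T fps_sum_nth)
    also have "\<dots> = - (\<Sum>i<k. w i ^ r)" using that by (simp add: g_def)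
    finally show ?thesis .
  qed
  then show ?thesis by blast
qed

lemma norm_le_of_power_sums_bound:
  fixes w :: "'i \<Rightarrow> complex"
  assumes "finite I" "B > 0" and bound: "\<And>r. r \<ge> 1 \<Longrightarrow> norm (\<Sum>i\<in>I. w i ^ r) \<le> C * B ^ r"
    and "i \<in> I"
  shows "norm (w i) \<le> B"
proof (rule ccontr)
  assume "\<not> norm (w i) \<le> B"
  txt \<open>Averaging \<open>(w j / w i0)\<^sup>r\<close> over \<open>r\<close> for a \<open>w i0\<close> of maximal norm detects the \<open>j\<close> with \<open>w j = w i0\<close>.\<close>
  define \<rho> where "\<rho> = Max (norm ` w ` I)"
  have "\<rho> \<in> norm ` w ` I" unfolding \<rho>_def using assms by (intro Max_in) auto
  then obtain i0 where i0: "i0 \<in> I" "norm (w i0) = \<rho>" by auto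
  have \<rho>_ge: "norm (w j) \<le> \<rho>" if "j \<in> I" for j unfolding \<rho>_def using that assms by (intro Max_ge) auto
  have \<rho>: "\<rho> > B" "\<rho> > 0" using \<open>\<not> norm (w i) \<le> B\<close> \<rho>_ge[of i] assms by auto
  define u where "u = inverse (w i0)"
  have u: "norm u = 1 / \<rho>" "w i0 * u = 1" using i0 \<rho> by (auto simp: u_def norm_inverse divide_inverse)
  define z where "z j = w j * u" for j
  have z_le: "norm (z j) \<le> 1" if "j \<in> I" for j
    using \<rho>_ge[OF that] \<rho> by (simp add: z_def norm_mult u)
  define G where "G R = (\<Sum>r=1..R. u ^ r * (\<Sum>i\<in>I. w i ^ r))" for R :: nat
  define c where "c = B / \<rho>"
  have c: "0 < c" "c < 1" using \<rho> assms by (auto simp: c_def)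
  have C: "C \<ge> 0" using order_trans[OF norm_ge_zero bound[of 1]] assms(2)
    by (simp add: zero_le_mult_iff)
  define L where "L = C * (1 / (1 - c))"
  have G_le: "norm (G R) \<le> L" for R
  proof -
    have "norm (G R) \<le> (\<Sum>r=1..R. norm (u ^ r * (\<Sum>i\<in>I. w i ^ r)))"
      unfolding G_def by (rule norm_sum)
    also have "\<dots> \<le> (\<Sum>r=1..R. C * c ^ r)"
    proof (intro sum_mono)
      fix r assume r: "r \<in> {1..R}"
      have "norm (u ^ r * (\<Sum>i\<in>I. w i ^ r)) \<le> (1 / \<rho>) ^ r * (C * B ^ r)"
        unfolding norm_mult norm_power u using r \<rho> by (intro mult_left_mono bound) auto
      then show "norm (u ^ r * (\<Sum>i\<in>I. w i ^ r)) \<le> C * c ^ r"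
        by (simp add: c_def power_divide)
    qed
    also have "\<dots> \<le> C * (\<Sum>r<Suc R. c ^ r)"
      unfolding sum_distrib_left[symmetric] using C c by (intro mult_left_mono sum_mono2) auto
    also have "(\<Sum>r<Suc R. c ^ r) = (1 - c ^ Suc R) / (1 - c)"
      using c by (subst sum_gp_strict) auto
    also have "\<dots> \<le> 1 / (1 - c)" using c by (intro divide_right_mono) auto
    finally show ?thesis using C by (simp add: L_def mult_left_mono)
  qed
  define J where "J = {j\<in>I. z j = 1}"
  define E where "E = (\<Sum>j\<in>I-J. 2 / norm (1 - z j))"
  \<comment> \<open>In \<open>G R\<close> every j with z j = 1 contributes R, and i0 is such a j.
    The other inner sums are geometric and bounded by 2 / |1 - z j|, while \<open>G R\<close> itself
    is bounded because B / \<rho> < 1. A large R gives the contradiction.\<close>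
  have "real R \<le> L + E" for R
  proof -
    have "G R = (\<Sum>j\<in>I. \<Sum>r=1..R. z j ^ r)"
      unfolding G_def by (simp add: sum_distrib_left z_def power_mult_distrib mult.commute) (rule sum.swap)
    also have "\<dots> = (\<Sum>j\<in>J. \<Sum>r=1..R. z j ^ r) + (\<Sum>j\<in>I-J. \<Sum>r=1..R. z j ^ r)"
      using assms(1) by (subst sum.subset_diff[of J I]) (auto simp: J_def)
    also have "(\<Sum>j\<in>J. \<Sum>r=1..R. z j ^ r) = of_nat (card J * R)"
      by (simp add: J_def)
    finally have eq: "of_nat (card J * R) = G R - (\<Sum>j\<in>I-J. \<Sum>r=1..R. z j ^ r)" by simp
    have "norm (\<Sum>j\<in>I-J. \<Sum>r=1..R. z j ^ r) \<le> E"
      unfolding E_def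
    proof (rule order_trans[OF norm_sum], intro sum_mono)
      fix j assume j: "j \<in> I - J"
      then have z: "z j \<noteq> 1" "norm (z j) \<le> 1" using z_le by (auto simp: J_def)
      have "(\<Sum>r=1..R. z j ^ r) = z j * (\<Sum>r<R. z j ^ r)"
        by (simp add: sum_distrib_left sum.atLeast1_atMost_eq)
      also have "\<dots> = z j * (1 - z j ^ R) / (1 - z j)"
        using z by (subst sum_gp_strict) auto
      finally have "norm (\<Sum>r=1..R. z j ^ r) = norm (z j) * norm (1 - z j ^ R) / norm (1 - z j)"
        by (simp add: norm_mult norm_divide)
      also have "\<dots> \<le> 1 * 2 / norm (1 - z j)"
      proof (intro divide_right_mono mult_mono)
        have "norm (z j ^ R) \<le> 1" using z by (simp add: norm_power power_le_one)
        then show "norm (1 - z j ^ R) \<le> 2" using norm_triangle_ineq4[of 1 "z j ^ R"] by simp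
      qed (use z in auto)
      finally show "norm (\<Sum>r=1..R. z j ^ r) \<le> 2 / norm (1 - z j)" by simp
    qed
    then have "norm (of_nat (card J * R) :: complex) \<le> L + E"
      unfolding eq using G_le[of R] by (intro order_trans[OF norm_triangle_ineq4] add_mono) auto
    then have "real (card J * R) \<le> L + E" by (simp only: norm_of_nat)
    moreover have "card J \<ge> 1"
      using i0 u assms(1) by (auto simp: J_def z_def Suc_le_eq card_gt_0_iff)
    then have "R \<le> card J * R" by simp
    ultimately show ?thesis by linarith
  qed
  then show False using reals_Archimedean2[of "L + E"] by (meson not_le)
qed

text \<open>Only even power sums are controlled, so the growth criterion is applied to the squares
  \<open>w i ^ 2\<close>, whose r-th power sum is minus \<open>S (2 * r)\<close>.\<close>

lemma newton_first_power_sum_bound: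
  fixes a S :: "nat \<Rightarrow> complex" and q :: real
  assumes "a 0 = 1" "\<And>n. n > k \<Longrightarrow> a n = 0"
    and "\<And>n. of_nat n * a n = (\<Sum>r=1..n. S r * a (n - r))"
    and "q > 0" and bound: "\<And>r. r \<ge> 1 \<Longrightarrow> norm (S (2 * r)) \<le> C * q ^ r"
  shows "norm (S 1) \<le> real k * sqrt q"
proof -
  obtain w where w: "\<And>r. r \<ge> 1 \<Longrightarrow> S r = - (\<Sum>i<k. w i ^ r)"
    using newton_power_sums[of a k S] assms by blast
  have "norm (w i ^ 2) \<le> q" if "i < k" for i
  proof (rule norm_le_of_power_sums_bound[where I = "{..<k}" and C = C and w = "\<lambda>i. w i ^ 2"])
    fix r :: nat assume "r \<ge> 1"
    then show "norm (\<Sum>i<k. (w i ^ 2) ^ r) \<le> C * q ^ r"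
      using bound[of r] w[of "2 * r"] by (simp add: power_mult)
  qed (use that assms in auto)
  then have "norm (w i) \<le> sqrt q" if "i < k" for i
    using that by (simp add: norm_power real_le_rsqrt)
  then have "norm (\<Sum>i<k. w i) \<le> real k * sqrt q"
    using sum_norm_bound[of "{..<k}" w "sqrt q"] by simp
  then show ?thesis using w[of 1] by simp
qed

section \<open>Polynomials and Frobenius powers\<close>

text \<open>Inside an algebraically closed field, with q > 1 a power of the characteristic, this
  expresses that the polynomial is defined over the subfield of q elements.\<close>

definition power_closed :: "nat \<Rightarrow> 'a::comm_semiring_1 poly \<Rightarrow> bool" where
  "power_closed q g \<longleftrightarrow> (\<forall>i. coeff g i ^ q = coeff g i)"

lemma minus_power_char_power:
  assumes "prime CHAR('a::comm_ring_1)" "q = CHAR('a) ^ e"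
  shows "(- x :: 'a) ^ q = - (x ^ q)"
proof -
  have "q > 0" using assms by (simp add: prime_gt_0_nat)
  then have "(x + - x) ^ q = 0" by (simp add: power_0_left)
  then show ?thesis using freshmans_dream'[OF assms, of x "- x"] by (simp add: add_eq_0_iff)
qed

lemma diff_power_char_power:
  assumes "prime CHAR('a::comm_ring_1)" "q = CHAR('a) ^ e"
  shows "(x - y :: 'a) ^ q = x ^ q - y ^ q"
  using freshmans_dream'[OF assms, of x "- y"] minus_power_char_power[OF assms, of y] by simp

lemma inj_power_char_power:
  assumes "prime CHAR('a::idom)" "q = CHAR('a) ^ e"
  shows "inj (\<lambda>x::'a. x ^ q)"
proof (rule injI)
  fix x y :: 'a assume "x ^ q = y ^ q"
  then have "(x - y) ^ q = 0" using diff_power_char_power[OF assms, of x y] by simp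
  then show "x = y" by simp
qed

lemma funpow_power: "((\<lambda>x. x ^ q) ^^ r) (x :: 'a::monoid_mult) = x ^ (q ^ r)"
  by (induction r) (auto simp: power_mult[symmetric] mult.commute)

lemma poly_power_char_power:
  fixes g :: "'a::idom poly"
  assumes "prime CHAR('a)" "q = CHAR('a) ^ e"
  shows "poly g x ^ q = poly (map_poly (\<lambda>c. c ^ q) g) (x ^ q)"
proof -
  have "q > 0" using assms by (simp add: prime_gt_0_nat)
  then have z: "(0::'a) ^ q = 0" by (simp add: power_0_left)
  have "poly g x ^ q = (\<Sum>i\<le>degree g. (coeff g i * x ^ i) ^ q)"
    unfolding poly_altdef by (rule freshmans_dream_sum'[OF assms])
  also have "\<dots> = (\<Sum>i\<le>degree g. coeff (map_poly (\<lambda>c. c ^ q) g) i * (x ^ q) ^ i)"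
    by (intro sum.cong refl) 
      (simp add: coeff_map_poly z power_mult_distrib power_mult[symmetric] mult.commute)
  also have "\<dots> = poly (map_poly (\<lambda>c. c ^ q) g) (x ^ q)"
    unfolding poly_altdef by (intro sum.mono_neutral_right)
      (auto intro!: degree_le simp: coeff_map_poly z coeff_eq_0)
  finally show ?thesis .
qed

lemma map_poly_power_eq: "power_closed q g \<Longrightarrow> q > 0 \<Longrightarrow> map_poly (\<lambda>c. c ^ q) g = (g :: 'a::idom poly)"
  by (intro poly_eqI) (simp add: coeff_map_poly power_closed_def)

lemma map_poly_power_mult:
  fixes g h :: "'a::idom poly"
  assumes "prime CHAR('a)" "q = CHAR('a) ^ e"
  shows "map_poly (\<lambda>c. c ^ q) (g * h) = map_poly (\<lambda>c. c ^ q) g * map_poly (\<lambda>c. c ^ q) h"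
proof (rule poly_eqI)
  fix n
  have "q > 0" using assms by (simp add: prime_gt_0_nat)
  then have z: "(0::'a) ^ q = 0" by (simp add: power_0_left)
  show "coeff (map_poly (\<lambda>c. c ^ q) (g * h)) n = coeff (map_poly (\<lambda>c. c ^ q) g * map_poly (\<lambda>c. c ^ q) h) n"
    by (simp add: coeff_map_poly z coeff_mult freshmans_dream_sum'[OF assms] power_mult_distrib)
qed

lemma lagrange_interpolation:
  fixes v :: "'a::field \<Rightarrow> 'a"
  assumes "finite A"
  shows "\<exists>h. (\<forall>k\<ge>card A. coeff h k = 0) \<and> (\<forall>a\<in>A. poly h a = v a)"
  using assms
proof induction
  case (insert b A)
  then obtain h where h: "\<forall>k\<ge>card A. coeff h k = 0" "\<forall>a\<in>A. poly h a = v a" by blast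
  define z where "z = (\<Prod>a\<in>A. [:- a, 1:])"
  have z: "poly z b \<noteq> 0" "\<And>a. a \<in> A \<Longrightarrow> poly z a = 0"
    using insert by (auto simp: z_def poly_prod)
  have degz: "degree z = card A"
    unfolding z_def by (subst degree_prod_eq_sum_degree) auto
  define h' where "h' = h + smult ((v b - poly h b) / poly z b) z"
  have "coeff h' k = 0" if "k \<ge> card (insert b A)" for k
    using that insert h degz by (auto simp: h'_def coeff_eq_0)
  moreover have "poly h' a = v a" if "a \<in> insert b A" for a
    using that z h by (auto simp: h'_def)
  ultimately show ?case by blast
qed (auto intro: exI[of _ 0])

lemma poly_eq_if_agree:
  fixes g h :: "'a::field poly"
  assumes "\<forall>k\<ge>card A. coeff g k = 0" "\<forall>k\<ge>card A. coeff h k = 0" "\<forall>a\<in>A. poly g a = poly h a"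
  shows "g = h"
proof (rule ccontr)
  assume "g \<noteq> h"
  then have nz: "g - h \<noteq> 0" by simp
  have "card A \<le> card {x. poly (g - h) x = 0}"
    using assms nz by (intro card_mono poly_roots_finite) auto
  also have "\<dots> \<le> degree (g - h)" using nz by (rule card_poly_roots_bound)
  finally have "coeff (g - h) (degree (g - h)) = 0" using assms by simp
  then show False using nz by (metis leading_coeff_0_iff)
qed

section \<open>Factorization into linear factors and separability\<close>

lemma prod_linear_nz: "(\<Prod>x\<in>#Z. [:- x, 1:]) \<noteq> (0 :: 'a::field poly)"
  by (auto simp: prod_mset_zero_iff)

lemma proots_prod_linear: "proots (\<Prod>x\<in>#Z. [:- x, 1:]) = (Z :: 'a::field multiset)"
  by (induction Z) (auto simp: proots_mult[OF _ prod_linear_nz] simp del: mult_pCons_left)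

lemma lead_coeff_prod_linear: "lead_coeff (\<Prod>x\<in>#Z. [:- x, 1 :: 'a::field:]) = 1"
proof (induction Z)
  case (add x Z)
  then show ?case using lead_coeff_mult[of "[:- x, 1:]"] by simp
qed simp

lemma degree_prod_linear: "degree (\<Prod>x\<in>#Z. [:- x, 1 :: 'a::field:]) = size Z"
  by (induction Z) (auto simp: degree_mult_eq[OF _ prod_linear_nz] simp del: mult_pCons_left)

lemma prod_linear_proots:
  fixes g :: "'a::alg_closed_field poly"
  assumes "g \<noteq> 0"
  shows "size (proots g) = degree g" "g = smult (lead_coeff g) (\<Prod>x\<in>#proots g. [:- x, 1:])"
proof -
  obtain Z where Z: "size Z = degree g" "g = smult (lead_coeff g) (\<Prod>x\<in>#Z. [:- x, 1:])"
    using alg_closed_imp_factorization[OF assms] by blast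
  have "proots g = Z"
    using assms by (subst Z(2)) (simp add: proots_prod_linear)
  then show "size (proots g) = degree g" "g = smult (lead_coeff g) (\<Prod>x\<in>#proots g. [:- x, 1:])"
    using Z by auto
qed

lemma proots_rsquarefree:
  fixes g :: "'a::field poly"
  assumes "rsquarefree g"
  shows "proots g = mset_set {x. poly g x = 0}"
proof (rule multiset_eqI)
  fix x
  have g: "g \<noteq> 0" "finite {x. poly g x = 0}" using assms by (auto simp: rsquarefree_def poly_roots_finite)
  then show "count (proots g) x = count (mset_set {x. poly g x = 0}) x"
    using assms by (cases "poly g x = 0") (simp_all add: rsquarefree_root_order order_0I)
qed

lemma rsquarefree_card_roots:
  fixes g :: "'a::alg_closed_field poly"
  assumes "rsquarefree g"
  shows "card {x. poly g x = 0} = degree g"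
  using prod_linear_proots(1)[of g] assms proots_rsquarefree[OF assms] by (auto simp: rsquarefree_def)

lemma rsquarefreeI:
  fixes g :: "'a::field poly"
  assumes "g \<noteq> 0" "\<And>a. poly g a = 0 \<Longrightarrow> poly (pderiv g) a \<noteq> 0"
  shows "rsquarefree g"
  unfolding rsquarefree_def
proof (intro conjI allI)
  fix a
  have "\<not> 2 \<le> order a g"
  proof
    assume "2 \<le> order a g"
    then have "[:- a, 1:] ^ 2 dvd g" by (simp add: order_divides)
    then obtain h where "g = [:- a, 1:] ^ 2 * h" by (rule dvdE)
    then have h: "g = [:- a, 1:] * ([:- a, 1:] * h)" by (simp only: power2_eq_square mult.assoc)
    have "poly g a = 0" unfolding h by simp
    moreover have "poly (pderiv g) a = 0" unfolding h pderiv_mult by simp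
    ultimately show False using assms(2) by blast
  qed
  then show "order a g = 0 \<or> order a g = 1" by linarith
qed (use assms in simp)

text \<open>X^q - X has derivative -1 in characteristic dividing q, so all its q roots are
  simple.\<close>

lemma card_power_fixed:
  assumes "prime CHAR('a::alg_closed_field)" "q = CHAR('a) ^ e" "q \<ge> 2"
  shows "card {x::'a. x ^ q = x} = q"
proof -
  define g where "g = monom 1 q - [:0, 1 :: 'a:]"
  have coeffg: "coeff g k = (if k = q then 1 else if k = 1 then -1 else 0)" for k
    using assms(3) by (auto simp: g_def coeff_pCons split: nat.split)
  have "degree g = q" using assms(3) by (intro antisym degree_le le_degree) (auto simp: coeffg)
  have "e > 0" using assms by (auto intro!: Nat.gr0I)
  then have q0: "of_nat q = (0 :: 'a)" unfolding assms(2) by (auto simp: power_0_left)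
  then have "pderiv g = [:-1:]" 
    by (simp add: g_def pderiv_diff pderiv_monom pderiv_pCons)
  moreover have "g \<noteq> 0" using \<open>degree g = q\<close> assms(3) by auto
  ultimately have "rsquarefree g" by (intro rsquarefreeI) auto
  then have "card {x. poly g x = 0} = q" using \<open>degree g = q\<close> by (simp add: rsquarefree_card_roots)
  also have "{x. poly g x = 0} = {x. x ^ q = x}" by (auto simp: g_def poly_monom)
  finally show ?thesis .
qed

section \<open>Weil's bound for power residue sums\<close>

text \<open>\<open>\<psi>\<close> is a nontrivial character of the group of d-th roots of unity,
  extended by 0 at 0. Composed with the power (q^r - 1) / d it becomes a multiplicative character of
  the field with q^r elements, so one \<open>\<psi>\<close> serves all extensions at once.\<close>

locale power_residue_sum =
  fixes f :: "'a::alg_closed_field poly" and q e d :: nat and \<psi> :: "'a \<Rightarrow> complex"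
  assumes prime_char: "prime CHAR('a)" and q_def: "q = CHAR('a) ^ e" and q_ge: "q \<ge> 3"
    and d_dvd: "d dvd q - 1"
    and f_closed: "power_closed q f" and f_sqfree: "rsquarefree f" and f_deg: "degree f > 0"
    and \<psi>_0: "\<psi> 0 = 0" and \<psi>_1: "\<psi> 1 = 1"
    and \<psi>_mult: "\<And>y z. y ^ d = 1 \<Longrightarrow> z ^ d = 1 \<Longrightarrow> \<psi> (y * z) = \<psi> y * \<psi> z"
    and \<psi>_nontrivial: "\<exists>y. y ^ d = 1 \<and> \<psi> y \<noteq> 1"
begin

definition "m = degree f"
definition "c r = (q ^ r - 1) div d"
definition "\<phi> = (\<lambda>x::'a. x ^ q)"
definition "\<chi> x = \<psi> (x ^ c 1)"
definition "A = {x. poly f x = 0}"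
text \<open>The factor that arises for each root when the resultant of \<open>f\<close> with a monic
  polynomial is expanded over the roots of \<open>f\<close> instead of the roots of the other
  polynomial.\<close>

definition "\<kappa> = lead_coeff f * (-1) ^ m"
definition "W Z = \<chi> (\<Prod>x\<in>#Z. poly f x)"
definition "M n = {Z. size Z = n \<and> image_mset \<phi> Z = Z}"
definition "G n = {g::'a poly. degree g = n \<and> lead_coeff g = 1 \<and> power_closed q g}"
definition "S r = (\<Sum>x | x ^ (q ^ r) = x. \<psi> (poly f x ^ c r))"
text \<open>The coefficient of degree n of the L-polynomial.\<close>

definition "a n = (\<Sum>Z\<in>M n. W Z)"
definition "E n g = \<chi> (\<kappa> ^ n * (\<Prod>\<alpha>\<in>A. poly g \<alpha>))"

lemma q_pos: "q > 0" and d_pos: "d > 0"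
  using q_ge d_dvd by (auto intro!: Nat.gr0I)

lemma dvd_power: "d dvd q ^ r - 1"
proof -
  have "[q = 1] (mod d)" using d_dvd q_ge by (simp add: cong_altdef_nat)
  then have "[q ^ r = 1 ^ r] (mod d)" by (rule cong_pow)
  then show ?thesis using q_pos by (simp add: cong_altdef_nat)
qed

lemma c_mult: "c r * d = q ^ r - 1"
  using dvd_power by (simp add: c_def)

lemma c_pos: "r > 0 \<Longrightarrow> c r > 0"
proof (rule Nat.gr0I)
  assume "r > 0" "c r = 0"
  then have "q ^ r - 1 = 0" using c_mult[of r] by simp
  moreover have "q ^ 1 \<le> q ^ r" using \<open>r > 0\<close> q_ge by (intro power_increasing) auto
  ultimately show False using q_ge by simp
qed

lemma sum_q_powers: "(\<Sum>i<r. q ^ i) * c 1 = c r"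
proof -
  have "(\<Sum>i<r. q ^ i) * (q - 1) = q ^ r - 1"
    using q_pos by (induction r) (auto simp: algebra_simps)
  then have "(\<Sum>i<r. q ^ i) * c 1 * d = c r * d"
    using c_mult[of r] c_mult[of 1] by (simp add: mult.assoc)
  then show ?thesis using d_pos by simp
qed

lemma char_power: "prime CHAR('a)" "q ^ r = CHAR('a) ^ (e * r)"
  using prime_char by (auto simp: q_def power_mult)

lemmas char_q = prime_char q_def

lemma inj_\<phi>: "inj \<phi>"
  unfolding \<phi>_def by (rule inj_power_char_power[OF char_q])

lemma funpow_\<phi>: "(\<phi> ^^ r) x = x ^ (q ^ r)"
  unfolding \<phi>_def by (rule funpow_power)

lemma f_nz: "f \<noteq> 0"
  using f_deg by auto

lemma poly_f_power: "poly f x ^ (q ^ r) = poly f (x ^ (q ^ r))"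
proof (induction r)
  case (Suc r)
  have "poly f x ^ (q ^ Suc r) = (poly f x ^ (q ^ r)) ^ q" by (simp add: power_mult[symmetric] mult.commute)
  also have "\<dots> = poly f ((x ^ (q ^ r)) ^ q)"
    unfolding Suc using poly_power_char_power[OF char_q, of f] map_poly_power_eq[OF f_closed q_pos] by simp
  also have "\<dots> = poly f (x ^ (q ^ Suc r))" by (simp add: power_mult[symmetric] mult.commute)
  finally show ?case .
qed simp

lemma finite_A: "finite A" and card_A: "card A = m"
  using f_nz f_sqfree by (auto simp: A_def m_def poly_roots_finite rsquarefree_card_roots)

lemma \<phi>_A: "\<phi> ` A = A"
proof -
  have "poly f (x ^ q) = poly f x ^ q" for x
    using poly_f_power[of x 1] by simp
  then have "\<phi> ` A \<subseteq> A"
    using q_pos by (auto simp: A_def \<phi>_def power_0_left)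
  then show ?thesis
    using finite_A inj_\<phi> by (meson card_image card_subset_eq inj_on_subset subset_UNIV)
qed

lemma card_fixed: "r > 0 \<Longrightarrow> card {x::'a. x ^ (q ^ r) = x} = q ^ r" 
  and finite_fixed: "r > 0 \<Longrightarrow> finite {x::'a. x ^ (q ^ r) = x}"
proof -
  assume "r > 0"
  then have ge: "q ^ 1 \<le> q ^ r" using q_ge by (intro power_increasing) auto
  then show *: "card {x::'a. x ^ (q ^ r) = x} = q ^ r"
    using q_ge by (intro card_power_fixed[OF char_power]) auto
  then show "finite {x::'a. x ^ (q ^ r) = x}" 
    using ge q_ge by (intro card_ge_0_finite) auto
qed

lemma \<chi>_1: "\<chi> 1 = 1" by (simp add: \<chi>_def \<psi>_1)

lemma root_power: "(y :: 'a) ^ q = y \<Longrightarrow> y \<noteq> 0 \<Longrightarrow> (y ^ c 1) ^ d = 1"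
proof -
  assume y: "y ^ q = y" "y \<noteq> 0"
  have "y ^ (q - 1) * y = 1 * y" using y power_minus_mult[OF q_pos, of y] by simp
  then have "y ^ (q - 1) = 1" using y by simp
  then show ?thesis using c_mult[of 1] by (simp add: power_mult[symmetric])
qed

lemma \<chi>_mult: "y ^ q = y \<Longrightarrow> z ^ q = z \<Longrightarrow> \<chi> (y * z) = \<chi> y * \<chi> z"
proof -
  assume *: "y ^ q = y" "z ^ q = z"
  show ?thesis
  proof (cases "y = 0 \<or> z = 0")
    case True
    then show ?thesis using c_pos[of 1] by (auto simp: \<chi>_def \<psi>_0 power_0_left)
  next
    case False
    then show ?thesis using * \<psi>_mult[OF root_power[of y] root_power[of z]]
      by (simp add: \<chi>_def power_mult_distrib)
  qed
qed

lemma prod_mset_power: "(\<Prod>x\<in>#Z. h x) ^ n = (\<Prod>x\<in>#Z. h x ^ n)" for h :: "'b \<Rightarrow> 'a"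
  by (induction Z) (auto simp: power_mult_distrib)

lemma prod_f_fixed: 
  assumes "image_mset \<phi> Z = Z"
  shows "(\<Prod>x\<in>#Z. poly f x) ^ q = (\<Prod>x\<in>#Z. poly f x)"
proof -
  have "(\<Prod>x\<in>#Z. poly f x) ^ q = (\<Prod>x\<in>#Z. poly f (\<phi> x))"
    using poly_f_power[of _ 1] by (simp add: prod_mset_power \<phi>_def)
  also have "\<dots> = (\<Prod>x\<in>#image_mset \<phi> Z. poly f x)"
    by (simp add: image_mset.compositionality comp_def)
  finally show ?thesis by (simp add: assms)
qed

lemma W_add: "image_mset \<phi> Z = Z \<Longrightarrow> image_mset \<phi> Y = Y \<Longrightarrow> W (Z + Y) = W Z * W Y"
  by (simp add: W_def \<chi>_mult prod_f_fixed)

text \<open>The product of \<open>f\<close> over a closed cycle is the norm of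
  \<open>poly f x\<close> from degree r, and composing \<chi> with this norm gives the character in
  degree r because the exponents multiply to \<open>c r\<close>. This identifies the cycle weights
  with the terms of \<open>S r\<close>.\<close>

lemma W_cycle: "W (cycle_mset \<phi> r x) = \<psi> (poly f x ^ c r)"
proof -
  have "(\<Prod>y\<in>#cycle_mset \<phi> r x. poly f y) = (\<Prod>i<r. poly f x ^ (q ^ i))"
    by (simp add: cycle_mset_def image_mset.compositionality comp_def funpow_\<phi> poly_f_power prod_unfold_prod_mset)
  also have "\<dots> = poly f x ^ (\<Sum>i<r. q ^ i)" by (rule power_sum[symmetric])
  finally show ?thesis
    by (simp only: W_def \<chi>_def power_mult[symmetric] sum_q_powers)
qed

text \<open>Raising the coefficients to the power q applies \<phi> to the roots. Hence a monic
  polynomial is defined over the field with q elements exactly when its root multiset is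
  invariant.\<close>

lemma G_M_bij: "bij_betw (\<lambda>Z. \<Prod>x\<in>#Z. [:- x, 1:]) (M n) (G n)"
proof -
  have map: "map_poly (\<lambda>c. c ^ q) (\<Prod>x\<in>#Z. [:- x, 1:]) = (\<Prod>x\<in>#image_mset \<phi> Z. [:- x, 1:])" for Z :: "'a multiset"
  proof (induction Z)
    case (add x Z)
    have "map_poly (\<lambda>c. c ^ q) [:- x, 1:] = [:- \<phi> x, 1:]"
      using q_pos minus_power_char_power[OF char_q, of x]
      by (simp add: map_poly_pCons \<phi>_def power_0_left)
    then show ?case using add by (simp add: map_poly_power_mult[OF char_q] del: mult_pCons_left)
  qed (use q_pos in \<open>simp add: map_poly_1\<close>)
  have closed: "power_closed q g \<longleftrightarrow> map_poly (\<lambda>c. c ^ q) g = g" for g :: "'a poly"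
    using q_pos by (auto simp: power_closed_def poly_eq_iff coeff_map_poly power_0_left)
  show ?thesis
  proof (rule bij_betw_byWitness[where f' = proots])
    show "\<forall>Z\<in>M n. proots (\<Prod>x\<in>#Z. [:- x, 1:]) = Z" by (simp add: proots_prod_linear)
    have monic: "(\<Prod>x\<in>#proots g. [:- x, 1:]) = g" "size (proots g) = n" if "g \<in> G n" for g
    proof -
      have "g \<noteq> 0" using that by (auto simp: G_def)
      then show "(\<Prod>x\<in>#proots g. [:- x, 1:]) = g" "size (proots g) = n"
        using that prod_linear_proots[of g] by (auto simp: G_def)
    qed
    then show "\<forall>g\<in>G n. (\<Prod>x\<in>#proots g. [:- x, 1:]) = g" by blast
    show "(\<lambda>Z. \<Prod>x\<in>#Z. [:- x, 1:]) ` M n \<subseteq> G n"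
      by (auto simp: M_def G_def closed map degree_prod_linear lead_coeff_prod_linear[unfolded degree_prod_linear])
    show "proots ` G n \<subseteq> M n"
    proof safe
      fix g assume g: "g \<in> G n"
      then have "map_poly (\<lambda>c. c ^ q) g = g" by (simp add: G_def closed)
      then have "(\<Prod>x\<in>#image_mset \<phi> (proots g). [:- x, 1:]) = (\<Prod>x\<in>#proots g. [:- x, 1:])"
        using map[of "proots g"] by (simp only: monic(1)[OF g])
      then have "image_mset \<phi> (proots g) = proots g" by (metis proots_prod_linear)
      then show "proots g \<in> M n" using monic(2)[OF g] by (simp add: M_def)
    qed
  qed
qed

lemma finite_G: "finite (G n)"
proof (rule finite_subset)
  show "G n \<subseteq> Poly ` {xs. set xs \<subseteq> {x. x ^ (q ^ 1) = x} \<and> length xs = n + 1}"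
  proof
    fix g assume g: "g \<in> G n"
    then have "g = Poly (map (coeff g) [0..<n+1])"
      by (intro poly_eqI) (auto simp: G_def nth_default_def coeff_eq_0 simp del: upt_Suc)
    then show "g \<in> Poly ` {xs. set xs \<subseteq> {x. x ^ (q ^ 1) = x} \<and> length xs = n + 1}"
      using g by (intro image_eqI[of _ _ "map (coeff g) [0..<n+1]"]) (auto simp: G_def power_closed_def)
  qed
  show "finite (Poly ` {xs. set xs \<subseteq> {x::'a. x ^ (q ^ 1) = x} \<and> length xs = n + 1})"
    using finite_fixed[of 1] by (intro finite_imageI finite_lists_length_eq) auto
qed

lemma finite_M: "finite (M n)"
  using G_M_bij finite_G bij_betw_finite by blast

lemma newton: "of_nat n * a n = (\<Sum>r=1..n. S r * a (n - r))"
proof -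
  have "of_nat n * (\<Sum>Z\<in>M n. W Z) =
    (\<Sum>r=1..n. (\<Sum>x | (\<phi> ^^ r) x = x. W (cycle_mset \<phi> r x)) * (\<Sum>Y\<in>M (n - r). W Y))"
    unfolding M_def
  proof (rule newton_identity_invariant_msets[OF inj_\<phi>])
    show "finite {Z. size Z = n \<and> image_mset \<phi> Z = Z}" for n
      using finite_M by (simp add: M_def)
    show "finite {x. (\<phi> ^^ r) x = x}" if "r \<ge> 1" for r
      using finite_fixed[of r] that by (simp add: funpow_\<phi>)
  qed (rule W_add)
  then show ?thesis by (simp add: a_def S_def W_cycle funpow_\<phi>)
qed

lemma a_0: "a 0 = 1"
proof -
  have "M 0 = {{#}}" by (auto simp: M_def)
  then show ?thesis by (simp add: a_def W_def \<chi>_1)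
qed

lemma f_factor: "poly f x = lead_coeff f * (\<Prod>\<alpha>\<in>A. x - \<alpha>)"
proof -
  have "f = smult (lead_coeff f) (\<Prod>\<alpha>\<in>A. [:- \<alpha>, 1:])"
    using prod_linear_proots(2)[OF f_nz] proots_rsquarefree[OF f_sqfree]
    by (simp add: A_def prod_unfold_prod_mset)
  then show ?thesis by (metis (no_types, lifting) poly_prod poly_smult prod.cong poly_pCons poly_0 mult_zero_right add.right_neutral mult.right_neutral uminus_add_conv_diff)
qed

text \<open>Both sides are the resultant of \<open>f\<close> and the monic polynomial with roots
  \<open>Z\<close>. On the right, \<open>Z\<close> enters only through the values of that polynomial
  on \<open>A\<close>, which makes interpolation available.\<close>

lemma prod_f_eq:
  "(\<Prod>x\<in>#Z. poly f x) = \<kappa> ^ size Z * (\<Prod>\<alpha>\<in>A. poly (\<Prod>x\<in>#Z. [:- x, 1:]) \<alpha>)"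
proof (induction Z)
  case (add x Z)
  have "poly f x = lead_coeff f * (\<Prod>\<alpha>\<in>A. (-1) * (\<alpha> - x))"
    by (simp add: f_factor)
  also have "\<dots> = \<kappa> * (\<Prod>\<alpha>\<in>A. \<alpha> - x)"
    unfolding prod.distrib by (simp add: \<kappa>_def card_A)
  finally have "(\<Prod>y\<in>#add_mset x Z. poly f y) =
      \<kappa> * (\<Prod>\<alpha>\<in>A. \<alpha> - x) * (\<kappa> ^ size Z * (\<Prod>\<alpha>\<in>A. poly (\<Prod>x\<in>#Z. [:- x, 1:]) \<alpha>))"
    using add by simp
  also have "\<dots> = \<kappa> ^ Suc (size Z) * (\<Prod>\<alpha>\<in>A. (\<alpha> - x) * poly (\<Prod>x\<in>#Z. [:- x, 1:]) \<alpha>)"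
    by (simp add: prod.distrib mult_ac)
  finally show ?case by (simp del: mult_pCons_left)
qed simp

lemma a_eq: "a n = (\<Sum>g\<in>G n. E n g)"
proof -
  have "(\<Sum>g\<in>G n. E n g) = (\<Sum>Z\<in>M n. E n (\<Prod>x\<in>#Z. [:- x, 1:]))"
    by (rule sum.reindex_bij_betw[OF G_M_bij, symmetric])
  also have "\<dots> = a n" unfolding a_def
    by (intro sum.cong refl) (auto simp: E_def W_def prod_f_eq M_def)
  finally show ?thesis ..
qed

end

lemma finite_roots_of_unity: "d > 0 \<Longrightarrow> finite {y::'a::field. y ^ d = 1}"
  and card_roots_of_unity_le: "d > 0 \<Longrightarrow> card {y::'a::field. y ^ d = 1} \<le> d"
proof -
  assume d: "d > 0"
  define g where "g = monom 1 d - [:1::'a:]"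
  have eq: "{y. y ^ d = 1} = {y. poly g y = 0}" by (auto simp: g_def poly_monom)
  have "coeff g d = 1" using d by (simp add: g_def coeff_pCons split: nat.split)
  then have nz: "g \<noteq> 0" by auto
  have "degree g \<le> d" unfolding g_def by (intro degree_diff_le degree_monom_le) auto
  then show "finite {y::'a. y ^ d = 1}" "card {y::'a. y ^ d = 1} \<le> d"
    unfolding eq using nz by (auto intro: poly_roots_finite order_trans[OF card_poly_roots_bound])
qed

section \<open>Vanishing of the L-coefficients and the bound in even degree\<close>

context power_residue_sum
begin

text \<open>If k is the exact degree of x, the exponents i and j differ by a multiple of k, and an
  element \<gamma> of the degree k extension does not notice the difference. This makes a map from
  the orbit of x to the conjugates of \<gamma> well defined.\<close>

lemma power_q_cong:
  assumes "x ^ (q ^ k) = x" "\<And>r. 1 \<le> r \<Longrightarrow> x ^ (q ^ r) = x \<Longrightarrow> k \<le> r" "k \<ge> 1"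
    and "(\<gamma>::'a) ^ (q ^ k) = \<gamma>" and eq: "x ^ (q ^ i) = (x::'a) ^ (q ^ j)"
  shows "\<gamma> ^ (q ^ i) = \<gamma> ^ (q ^ j)"
  using eq
proof (induction i j rule: linorder_wlog)
  case (le i j)
  define r where "r = j - i"
  have j: "j = i + r" using le by (simp add: r_def)
  have "(\<phi> ^^ (i + r)) x = (\<phi> ^^ i) x" using le by (simp add: funpow_\<phi> j)
  then have xr: "x ^ (q ^ r) = x" using funpow_inj_cancel[OF inj_\<phi>, of i r x] by (simp add: funpow_\<phi>)
  have iter: "y ^ (q ^ (n * k)) = y" if "y ^ (q ^ k) = y" for n and y :: 'a
    by (induction n) (auto simp: power_add power_mult that)
  have "x ^ (q ^ (r mod k)) = (x ^ (q ^ (r div k * k))) ^ (q ^ (r mod k))"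
    by (simp add: iter[OF assms(1)])
  also have "\<dots> = x ^ (q ^ (r div k * k + r mod k))" by (simp only: power_add power_mult)
  finally have "x ^ (q ^ (r mod k)) = x" using xr by simp
  then have "r mod k = 0"
    using assms(2)[of "r mod k"] assms(3) mod_less_divisor[of k r] by linarith
  then have "r = r div k * k" by (metis add.right_neutral div_mult_mod_eq)
  then have "\<gamma> ^ (q ^ r) = \<gamma>" using iter[OF assms(4), of "r div k"] by simp
  then show ?case by (simp add: j power_add power_mult mult.commute[of "q ^ i"])
next
  case (sym i j)
  then show ?case by metis
qed

text \<open>Take one Frobenius orbit of roots, of length k, and send its points to the conjugates of
  some \<gamma> with \<gamma> ^ c k = \<eta>, where \<psi> \<eta> \<noteq> 1; all other roots are
  sent to 1. The product is then the norm of \<gamma>, and \<chi> takes the value \<psi> \<eta> on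
  it.\<close>

lemma equivariant_exists:
  "\<exists>v. (\<forall>\<alpha>\<in>A. v \<alpha> \<noteq> 0 \<and> v (\<phi> \<alpha>) = v \<alpha> ^ q) \<and> \<chi> (\<Prod>\<alpha>\<in>A. v \<alpha>) \<noteq> 1 \<and> (\<Prod>\<alpha>\<in>A. v \<alpha>) ^ q = (\<Prod>\<alpha>\<in>A. v \<alpha>)"
proof -
  obtain x where x: "x \<in> A"
    using alg_closed_imp_poly_has_root[OF f_deg] by (auto simp: A_def)
  have xA: "x ^ (q ^ i) \<in> A" for i
  proof (induction i)
    case (Suc i)
    then have "\<phi> (x ^ (q ^ i)) \<in> A" using \<phi>_A by blast
    then show ?case by (simp add: \<phi>_def power_mult[symmetric] mult.commute)
  qed (use x in simp)
  have "\<not> inj (\<lambda>i. (\<phi> ^^ i) x)"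
    using xA finite_A unfolding funpow_\<phi>
    by (meson finite_subset image_subsetI infinite_UNIV_nat finite_imageD)
  then obtain i j where "i < j" "(\<phi> ^^ i) x = (\<phi> ^^ j) x"
    unfolding inj_def by (metis linorder_neqE_nat)
  then have "x ^ (q ^ (j - i)) = x"
    using funpow_inj_cancel[OF inj_\<phi>, of i "j - i" x] by (simp add: funpow_\<phi>)
  then have ex: "\<exists>r. 1 \<le> r \<and> x ^ (q ^ r) = x" using \<open>i < j\<close> by (intro exI[of _ "j - i"]) auto
  define k where "k = (LEAST r. 1 \<le> r \<and> x ^ (q ^ r) = x)"
  have k: "1 \<le> k" "x ^ (q ^ k) = x" using LeastI_ex[OF ex] by (auto simp: k_def)
  have k_le: "k \<le> r" if "1 \<le> r" "x ^ (q ^ r) = x" for r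
    unfolding k_def using that by (intro Least_le) auto
  obtain \<eta> where \<eta>: "\<eta> ^ d = 1" "\<psi> \<eta> \<noteq> 1" using \<psi>_nontrivial by blast
  have "c k > 0" using c_pos k by simp
  then obtain \<gamma> where \<gamma>: "\<gamma> ^ c k = \<eta>" using nth_root_exists by blast
  have "\<gamma> ^ (q ^ k - 1) = 1" using \<eta> \<gamma> c_mult[of k] by (metis power_mult)
  moreover have "\<gamma> ^ (q ^ k) = \<gamma> ^ (q ^ k - 1) * \<gamma>"
    using power_minus_mult[of "q ^ k" \<gamma>] q_pos by simp
  ultimately have \<gamma>k: "\<gamma> ^ (q ^ k) = \<gamma>" by simp
  have \<gamma>0: "\<gamma> \<noteq> 0" using \<gamma> \<eta> \<open>c k > 0\<close> d_pos by (auto simp: power_0_left)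
  define Or where "Or = {x ^ (q ^ i) |i. True}"
  define v where "v \<alpha> = (if \<alpha> \<in> Or then \<gamma> ^ (q ^ (SOME i. \<alpha> = x ^ (q ^ i))) else 1)" for \<alpha>
  have v: "v (x ^ (q ^ i)) = \<gamma> ^ (q ^ i)" for i
  proof -
    have "x ^ (q ^ i) = x ^ (q ^ (SOME j. x ^ (q ^ i) = x ^ (q ^ j)))" by (rule someI[of _ i]) simp
    then have "\<gamma> ^ (q ^ i) = \<gamma> ^ (q ^ (SOME j. x ^ (q ^ i) = x ^ (q ^ j)))"
      using power_q_cong[OF k(2) k_le k(1) \<gamma>k] by blast
    then show ?thesis by (auto simp: v_def Or_def)
  qed
  have equi: "v (\<phi> \<alpha>) = v \<alpha> ^ q" for \<alpha>
  proof (cases "\<alpha> \<in> Or")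
    case True
    then obtain i where "\<alpha> = x ^ (q ^ i)" by (auto simp: Or_def)
    then show ?thesis using v[of i] v[of "Suc i"]
      by (simp add: \<phi>_def power_mult[symmetric] mult.commute)
  next
    case False
    have "\<phi> \<alpha> \<notin> Or"
    proof
      assume "\<phi> \<alpha> \<in> Or"
      then obtain i where i: "\<phi> \<alpha> = x ^ (q ^ i)" by (auto simp: Or_def)
      \<comment> \<open>The orbit is finite, so it is also closed under preimages: the inverse of
        \<phi> acts on it as the (k - 1)-th iterate.\<close>
      obtain k' where k': "k = Suc k'" using k(1) by (cases k) auto
      have "x ^ (q ^ i) = (x ^ (q ^ k)) ^ (q ^ i)" by (simp add: k)
      also have "\<dots> = \<phi> (x ^ (q ^ (k' + i)))"
        by (simp add: \<phi>_def power_mult[symmetric] k' power_add mult_ac)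
      finally have "\<phi> \<alpha> = \<phi> (x ^ (q ^ (k' + i)))" using i by simp
      then have "\<alpha> = x ^ (q ^ (k' + i))" using inj_\<phi> by (simp add: inj_def)
      then show False using False by (auto simp: Or_def)
    qed
    then show ?thesis using False by (simp add: v_def)
  qed
  have inj: "inj_on (\<lambda>i. x ^ (q ^ i)) {..<k}"
  proof (rule linorder_inj_onI)
    fix i j assume "i < j" "i \<in> {..<k}" "j \<in> {..<k}"
    then have "x ^ (q ^ (j - i)) \<noteq> x" using k_le[of "j - i"] by fastforce
    then show "x ^ (q ^ i) \<noteq> x ^ (q ^ j)"
      using funpow_inj_cancel[OF inj_\<phi>, of i "j - i" x] \<open>i < j\<close> by (auto simp: funpow_\<phi>)
  qed auto
  have Or: "Or = (\<lambda>i. x ^ (q ^ i)) ` {..<k}"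
  proof (intro equalityI subsetI)
    fix y assume "y \<in> Or"
    then obtain i where y: "y = x ^ (q ^ i)" by (auto simp: Or_def)
    have "x ^ (q ^ (n * k)) = x" for n
      by (induction n) (auto simp: power_add power_mult k)
    then have "x ^ (q ^ i) = x ^ (q ^ (i mod k))"
      by (metis div_mult_mod_eq power_add power_mult)
    then show "y \<in> (\<lambda>i. x ^ (q ^ i)) ` {..<k}" using k y by auto
  qed (auto simp: Or_def)
  have "(\<Prod>\<alpha>\<in>A. v \<alpha>) = (\<Prod>\<alpha>\<in>Or. v \<alpha>)"
    using finite_A xA by (intro prod.mono_neutral_right) (auto simp: Or_def v_def)
  also have "\<dots> = (\<Prod>i<k. \<gamma> ^ (q ^ i))"
    unfolding Or by (subst prod.reindex[OF inj]) (simp add: v)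
  also have "\<dots> = \<gamma> ^ (\<Sum>i<k. q ^ i)" by (rule power_sum[symmetric])
  finally have prod: "(\<Prod>\<alpha>\<in>A. v \<alpha>) = \<gamma> ^ (\<Sum>i<k. q ^ i)" .
  have "\<chi> (\<Prod>\<alpha>\<in>A. v \<alpha>) = \<psi> \<eta>"
    by (simp only: prod \<chi>_def power_mult[symmetric] sum_q_powers \<gamma>)
  moreover have "(\<Prod>\<alpha>\<in>A. v \<alpha>) ^ q = (\<Prod>\<alpha>\<in>A. v \<alpha>)"
  proof -
    have "(\<Prod>\<alpha>\<in>A. v \<alpha>) ^ q = (\<Prod>\<alpha>\<in>A. v (\<phi> \<alpha>))" by (simp add: prod_power_distrib equi)
    also have "\<dots> = (\<Prod>\<alpha>\<in>\<phi> ` A. v \<alpha>)"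
      using inj_\<phi> by (subst prod.reindex) (auto intro: inj_on_subset)
    finally show ?thesis by (simp add: \<phi>_A)
  qed
  moreover have "v \<alpha> \<noteq> 0" for \<alpha> using \<gamma>0 by (simp add: v_def)
  ultimately show ?thesis using \<eta> equi by (intro exI[of _ v]) auto
qed

text \<open>Raising the coefficients of the interpolating polynomial to the power q gives another
  interpolating polynomial of the same equivariant data within the same degree bound. Uniqueness
  forces the coefficients into the field with q elements.\<close>

lemma interpolation_closed:
  assumes "\<And>\<alpha>. \<alpha> \<in> A \<Longrightarrow> v (\<phi> \<alpha>) = v \<alpha> ^ q"
  shows "\<exists>h. (\<forall>k\<ge>m. coeff h k = 0) \<and> (\<forall>\<alpha>\<in>A. poly h \<alpha> = v \<alpha>) \<and> power_closed q h"
proof -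
  obtain h where h: "\<forall>k\<ge>card A. coeff h k = 0" "\<forall>\<alpha>\<in>A. poly h \<alpha> = v \<alpha>"
    using lagrange_interpolation[OF finite_A] by blast
  define h' where "h' = map_poly (\<lambda>c. c ^ q) h"
  have ch': "coeff h' k = coeff h k ^ q" for k using q_pos by (simp add: h'_def coeff_map_poly power_0_left)
  have "poly h' \<alpha> = poly h \<alpha>" if "\<alpha> \<in> A" for \<alpha>
  proof -
    obtain \<beta> where \<beta>: "\<beta> \<in> A" "\<alpha> = \<phi> \<beta>" using \<phi>_A \<open>\<alpha> \<in> A\<close> by blast
    have "poly h' \<alpha> = poly h \<beta> ^ q"
      unfolding h'_def \<beta> \<phi>_def by (rule poly_power_char_power[OF char_q, symmetric])
    also have "\<dots> = poly h \<alpha>" using assms[OF \<beta>(1)] h(2) \<beta> that by auto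
    finally show ?thesis .
  qed
  then have "h' = h" using h q_pos by (intro poly_eq_if_agree[of A]) (auto simp: ch' power_0_left)
  then have "power_closed q h" using ch' by (simp add: power_closed_def)
  then show ?thesis using h card_A by auto
qed

lemma poly_G_\<phi>: "power_closed q g \<Longrightarrow> poly g (\<phi> \<alpha>) = poly g \<alpha> ^ q"
  using poly_power_char_power[OF char_q, of g \<alpha>] map_poly_power_eq[OF _ q_pos, of g] by (simp add: \<phi>_def)

lemma prod_G_fixed: "power_closed q g \<Longrightarrow> (\<Prod>\<alpha>\<in>A. poly g \<alpha>) ^ q = (\<Prod>\<alpha>\<in>A. poly g \<alpha>)"
proof -
  assume "power_closed q g"
  then have "(\<Prod>\<alpha>\<in>A. poly g \<alpha>) ^ q = (\<Prod>\<alpha>\<in>A. poly g (\<phi> \<alpha>))" by (simp add: prod_power_distrib poly_G_\<phi>)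
  also have "\<dots> = (\<Prod>\<alpha>\<in>\<phi> ` A. poly g \<alpha>)"
    using inj_\<phi> by (subst prod.reindex) (auto intro: inj_on_subset)
  finally show ?thesis by (simp add: \<phi>_A)
qed

lemma \<kappa>_fixed: "(\<kappa> ^ n) ^ q = \<kappa> ^ n"
proof -
  have "(-1 :: 'a) ^ q = -1" using minus_power_char_power[OF char_q, of "1::'a"] by simp
  then have "((-1 :: 'a) ^ m) ^ q = (-1) ^ m" by (metis power_mult mult.commute)
  then have "\<kappa> ^ q = \<kappa>" using f_closed by (simp add: \<kappa>_def power_mult_distrib power_closed_def)
  then show ?thesis by (metis power_mult mult.commute)
qed

text \<open>Multiplying the values on \<open>A\<close> by an equivariant \<open>v\<close> permutes the monic polynomials of degree \<open>n \<ge> m\<close>,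
  since values on \<open>A\<close> can be adjusted by interpolation in degree less than \<open>m\<close>.\<close>

lemma a_eq_0:
  assumes "n \<ge> m"
  shows "a n = 0"
proof -
  obtain v where v: "\<And>\<alpha>. \<alpha> \<in> A \<Longrightarrow> v \<alpha> \<noteq> 0" "\<And>\<alpha>. \<alpha> \<in> A \<Longrightarrow> v (\<phi> \<alpha>) = v \<alpha> ^ q"
    and v\<chi>: "\<chi> (\<Prod>\<alpha>\<in>A. v \<alpha>) \<noteq> 1" and vq: "(\<Prod>\<alpha>\<in>A. v \<alpha>) ^ q = (\<Prod>\<alpha>\<in>A. v \<alpha>)"
    using equivariant_exists by blast
  \<comment> \<open>What is interpolated is the correction (v - 1) g, not v g: added to
    \<open>g\<close>, a polynomial of degree below m \<le> n leaves the leading coefficient 1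
    untouched.\<close>
  have "\<exists>h. (\<forall>k\<ge>m. coeff h k = 0) \<and> (\<forall>\<alpha>\<in>A. poly h \<alpha> = (v \<alpha> - 1) * poly g \<alpha>) \<and> power_closed q h" 
    if "g \<in> G n" for g
    using that v poly_G_\<phi>[of g] diff_power_char_power[OF char_q, of _ "1::'a"]
    by (intro interpolation_closed) (auto simp: G_def power_mult_distrib)
  then obtain L where L: "\<And>g k. g \<in> G n \<Longrightarrow> k \<ge> m \<Longrightarrow> coeff (L g) k = 0"
      "\<And>g \<alpha>. g \<in> G n \<Longrightarrow> \<alpha> \<in> A \<Longrightarrow> poly (L g) \<alpha> = (v \<alpha> - 1) * poly g \<alpha>"
      "\<And>g. g \<in> G n \<Longrightarrow> power_closed q (L g)"
    by metis
  define T where "T g = g + L g" for g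
  have Tv: "poly (T g) \<alpha> = v \<alpha> * poly g \<alpha>" if "g \<in> G n" "\<alpha> \<in> A" for g \<alpha>
    using L(2)[OF that] by (simp add: T_def algebra_simps)
  have TG: "T g \<in> G n" if g: "g \<in> G n" for g
  proof -
    have co: "coeff (T g) k = coeff g k" if "k \<ge> m" for k using L(1)[OF g that] by (simp add: T_def)
    have "coeff g n = 1" using g by (auto simp: G_def)
    then have "degree (T g) = n" using g co assms
      by (intro antisym degree_le le_degree) (auto simp: G_def coeff_eq_0)
    moreover have "power_closed q (T g)"
      using g L(3)[OF g] freshmans_dream'[OF char_q]
      by (auto simp: power_closed_def T_def G_def)
    ultimately show ?thesis using \<open>coeff g n = 1\<close> co[OF assms] by (simp add: G_def)
  qed
  have "inj_on T (G n)"
  proof (rule inj_onI)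
    fix g h assume gh: "g \<in> G n" "h \<in> G n" "T g = T h"
    have "coeff (g - h) k = 0" if "k \<ge> m" for k
    proof -
      have "coeff (T g) k = coeff (T h) k" using gh by simp
      then show ?thesis using L(1) gh that by (simp add: T_def)
    qed
    moreover have "poly (g - h) \<alpha> = 0" if "\<alpha> \<in> A" for \<alpha>
    proof -
      have "v \<alpha> * poly g \<alpha> = v \<alpha> * poly h \<alpha>" using Tv gh that by metis
      then show ?thesis using v(1)[OF that] by simp
    qed
    ultimately have "g - h = 0" by (intro poly_eq_if_agree[of A]) (auto simp: card_A)
    then show "g = h" by simp
  qed
  moreover have "T ` G n \<subseteq> G n" using TG by blast
  ultimately have "T ` G n = G n"
    using finite_G by (meson card_image card_subset_eq)
  then have "a n = (\<Sum>g\<in>G n. E n (T g))"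
    unfolding a_eq using \<open>inj_on T (G n)\<close> by (metis (no_types, lifting) sum.reindex_cong)
  also have "\<dots> = (\<Sum>g\<in>G n. \<chi> (\<Prod>\<alpha>\<in>A. v \<alpha>) * E n g)"
  proof (intro sum.cong refl)
    fix g assume g: "g \<in> G n"
    have "E n (T g) = \<chi> ((\<Prod>\<alpha>\<in>A. v \<alpha>) * (\<kappa> ^ n * (\<Prod>\<alpha>\<in>A. poly g \<alpha>)))"
      by (simp add: E_def Tv[OF g] prod.distrib mult_ac)
    also have "\<dots> = \<chi> (\<Prod>\<alpha>\<in>A. v \<alpha>) * E n g"
      unfolding E_def using g
      by (intro \<chi>_mult vq) (simp add: power_mult_distrib \<kappa>_fixed prod_G_fixed G_def)
    finally show "E n (T g) = \<chi> (\<Prod>\<alpha>\<in>A. v \<alpha>) * E n g" .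
  qed
  also have "\<dots> = \<chi> (\<Prod>\<alpha>\<in>A. v \<alpha>) * a n" by (simp add: a_eq sum_distrib_left)
  finally show ?thesis using v\<chi> by simp
qed

lemma norm_\<psi>: "y ^ d = 1 \<Longrightarrow> norm (\<psi> y) = 1"
proof -
  assume y: "y ^ d = 1"
  have "\<psi> (y ^ n) = \<psi> y ^ n" for n
  proof (induction n)
    case (Suc n)
    have "(y ^ n) ^ d = 1" using y by (metis power_commutes power_mult power_one mult.commute)
    then show ?case using Suc y by (simp add: \<psi>_mult)
  qed (simp add: \<psi>_1)
  then have "\<psi> y ^ d = 1" using y \<psi>_1 by metis
  then show ?thesis using d_pos by (metis norm_ge_zero norm_one norm_power power_eq_1_iff gr_implies_not0 neq0_conv)
qed

lemma sum_\<psi>_0: "(\<Sum>y | y ^ d = 1. \<psi> y) = 0"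
proof -
  obtain \<eta> where \<eta>: "\<eta> ^ d = 1" "\<psi> \<eta> \<noteq> 1" using \<psi>_nontrivial by blast
  have "\<eta> \<noteq> 0" using \<eta> d_pos by (auto simp: power_0_left)
  then have "(\<Sum>y | y ^ d = 1. \<psi> y) = (\<Sum>y | y ^ d = 1. \<psi> (\<eta> * y))"
    using \<eta> by (intro sum.reindex_bij_witness[of _ "\<lambda>y. \<eta> * y" "\<lambda>y. y / \<eta>"]) 
      (auto simp: power_mult_distrib power_divide)
  also have "\<dots> = \<psi> \<eta> * (\<Sum>y | y ^ d = 1. \<psi> y)"
    using \<eta> by (simp add: sum_distrib_left \<psi>_mult)
  finally show ?thesis using \<eta> by simp
qed

lemma value_root_of_unity:
  assumes "x ^ (q ^ r) = x" "poly f x \<noteq> 0"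
  shows "(poly f x ^ c r) ^ d = 1"
proof -
  have "poly f x ^ (q ^ r) = poly f x" using poly_f_power[of x r] assms by simp
  then have "poly f x ^ (q ^ r - 1) * poly f x = 1 * poly f x"
    using power_minus_mult[of "q ^ r" "poly f x"] q_pos by simp
  then have "poly f x ^ (q ^ r - 1) = 1" using assms by simp
  then show ?thesis using c_mult[of r] by (simp add: power_mult[symmetric])
qed

text \<open>Stepanov's bound gives \<open>N y\<close> \<le> \<open>b\<close> for every fibre. As
  \<psi> sums to 0 over the roots of unity, \<open>b\<close> can be subtracted from each
  \<open>N y\<close> at no cost. The differences then have one sign, so their absolute values add up
  to a quantity governed by the total count, which is s^2 up to the at most \<open>m\<close> zeros
  of \<open>f\<close>.\<close>

lemma S_even_bound:
  assumes "r \<ge> 1"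
  shows "norm (S (2 * r)) \<le> (d * (4 * m + 6) + m) * real q ^ r"
proof -
  define s where "s = q ^ r"
  define K where "K = {x::'a. x ^ (s ^ 2) = x}"
  have Q: "q ^ (2 * r) = s ^ 2" by (simp add: s_def power_mult[symmetric] mult.commute)
  have "q ^ 1 \<le> q ^ r" using assms q_ge by (intro power_increasing) auto
  then have s: "s \<ge> 3" using q_ge by (simp add: s_def)
  have K: "finite K" "card K = s ^ 2"
    using card_fixed[of "2 * r"] finite_fixed[of "2 * r"] assms by (auto simp: K_def Q)
  define g where "g x = poly f x ^ c (2 * r)" for x
  define U where "U = {y::'a. y ^ d = 1}"
  have U: "finite U" "card U \<le> d" using finite_roots_of_unity[OF d_pos] card_roots_of_unity_le[OF d_pos] by (auto simp: U_def)
  have "0 \<notin> U" using d_pos by (auto simp: U_def power_0_left)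
  define N where "N y = card {x\<in>K. g x = y}" for y
  have "g x \<in> insert 0 U" if "x \<in> K" for x
  proof (cases "poly f x = 0")
    case True
    then show ?thesis using c_pos[of "2 * r"] assms by (simp add: g_def power_0_left)
  next
    case False
    then show ?thesis
      using value_root_of_unity[of x "2 * r"] that by (simp add: g_def U_def K_def Q)
  qed
  then have gK: "g ` K \<subseteq> insert 0 U" by blast
  have "S (2 * r) = (\<Sum>x\<in>K. \<psi> (g x))" by (simp add: S_def K_def g_def Q)
  also have "\<dots> = (\<Sum>y\<in>insert 0 U. \<Sum>x | x \<in> K \<and> g x = y. \<psi> (g x))"
    using U K gK by (intro sum.group[symmetric]) auto
  also have "\<dots> = (\<Sum>y\<in>insert 0 U. of_nat (N y) * \<psi> y)"
    by (intro sum.cong refl) (simp add: N_def)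
  also have "\<dots> = (\<Sum>y\<in>U. of_nat (N y) * \<psi> y)"
    using U \<open>0 \<notin> U\<close> by (simp add: \<psi>_0)
  finally have S: "S (2 * r) = (\<Sum>y\<in>U. of_nat (N y) * \<psi> y)" .
  have "s ^ 2 = (\<Sum>y\<in>insert 0 U. N y)"
    using sum.group[OF K(1) _ gK, of "\<lambda>_. 1::nat"] U K by (simp add: N_def)
  also have "\<dots> = N 0 + (\<Sum>y\<in>U. N y)" using U \<open>0 \<notin> U\<close> by simp
  also have "N 0 \<le> m"
  proof -
    have "{x\<in>K. g x = 0} \<subseteq> A" using c_pos[of "2 * r"] assms by (auto simp: g_def A_def)
    then show ?thesis unfolding N_def card_A[symmetric] using finite_A by (rule card_mono[rotated])
  qed
  finally have total: "s ^ 2 \<le> m + (\<Sum>y\<in>U. N y)" by simp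
  define b where "b = real s ^ 2 / d + real (4 * m + 6) * s"
  have db: "real d * b = real s ^ 2 + real (d * (4 * m + 6) * s)"
    using d_pos by (simp add: b_def distrib_left)
  obtain \<alpha> where \<alpha>: "\<alpha> \<in> A" using alg_closed_imp_poly_has_root[OF f_deg] by (auto simp: A_def)
  have N_le: "real (N y) \<le> b" for y
  proof -
    have eq: "{x\<in>K. g x = y} = {x. x ^ (s ^ 2) = x \<and> poly f x ^ ((s ^ 2 - 1) div d) = y}"
      by (auto simp: K_def g_def c_def Q)
    have sc: "s = CHAR('a) ^ (e * r)" unfolding s_def by (rule char_power(2))
    have "d dvd s - 1" using dvd_power by (simp add: s_def)
    moreover have "order \<alpha> f = 1" using f_sqfree f_nz \<alpha> by (intro rsquarefree_root_order) (auto simp: A_def)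
    ultimately have "d * N y \<le> s ^ 2 + d * (4 * m + 6) * s"
      unfolding N_def m_def eq by (intro stepanov_bound[OF char_power(1) sc s _ f_nz])
    then have "real (d * N y) \<le> real (s ^ 2 + d * (4 * m + 6) * s)" by (simp only: of_nat_le_iff)
    then have "real d * real (N y) \<le> real d * b" unfolding db by simp
    then show ?thesis using d_pos by (subst (asm) mult_le_cancel_left_pos) auto
  qed
  have "S (2 * r) = (\<Sum>y\<in>U. (of_nat (N y) - of_real b) * \<psi> y)"
    using sum_\<psi>_0 by (simp add: S left_diff_distrib sum_subtractf sum_distrib_left[symmetric] U_def)
  also have "norm \<dots> \<le> (\<Sum>y\<in>U. b - N y)"
  proof (rule order_trans[OF norm_sum], intro sum_mono)
    fix y assume "y \<in> U"
    have "norm (of_nat (N y) - of_real b :: complex) = norm (of_real (real (N y) - b) :: complex)" by simp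
    also have "\<dots> = b - N y" unfolding norm_of_real using N_le[of y] by simp
    finally show "norm ((of_nat (N y) - of_real b) * \<psi> y) \<le> b - N y"
      using \<open>y \<in> U\<close> by (simp add: norm_mult norm_\<psi> U_def)
  qed
  also have "\<dots> = card U * b - real (\<Sum>y\<in>U. N y)" by (simp add: sum_subtractf)
  also have "\<dots> \<le> d * b - (real s ^ 2 - m)"
  proof (intro diff_mono mult_right_mono)
    show "b \<ge> 0" by (simp add: b_def)
    have "real (s ^ 2) \<le> real (m + (\<Sum>y\<in>U. N y))" using total by (simp only: of_nat_le_iff)
    then show "real s ^ 2 - m \<le> real (\<Sum>y\<in>U. N y)" by simp
  qed (use U in auto)
  also have "\<dots> = d * (4 * m + 6) * s + m" unfolding db by simp
  also have "\<dots> \<le> d * (4 * m + 6) * s + m * s" using s by (simp add: mult_le_cancel_left1)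
  finally show ?thesis by (simp add: s_def algebra_simps)
qed

theorem weil_bound:
  "norm (\<Sum>x | x ^ q = x. \<psi> (poly f x ^ ((q - 1) div d))) \<le> real (degree f - 1) * sqrt q"
proof -
  have "norm (S 1) \<le> real (m - 1) * sqrt (real q)"
  proof (rule newton_first_power_sum_bound[OF a_0 _ newton _ S_even_bound])
    show "a n = 0" if "n > m - 1" for n using that a_eq_0[of n] by simp
  qed (use q_pos in auto)
  then show ?thesis by (simp add: S_def c_def m_def)
qed

end

section \<open>Counting power residues\<close>

text \<open>Orthogonality of the d characters of the roots of unity isolates the fibre over \<tau>.
  The trivial character contributes q minus the number of zeros of \<open>f\<close>, the others at
  most (degree f - 1) sqrt q each. The zeros are absorbed by using degree f in place of degree f -
  1.\<close>

theorem power_residue_count: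
  fixes f :: "'a::alg_closed_field poly"
  assumes q: "prime CHAR('a)" "q = CHAR('a) ^ e" "q \<ge> 3" and d: "d dvd q - 1" "d \<ge> 2"
    and f: "power_closed q f" "rsquarefree f" "degree f > 0"
    and G: "(G::'a) ^ d = 1" "inj_on (\<lambda>i. G ^ i) {..<d}" and \<tau>: "\<tau> ^ d = 1"
  shows "\<bar>real (card {x. x ^ q = x \<and> poly f x ^ ((q - 1) div d) = \<tau>}) - q / d\<bar> \<le> degree f * sqrt q"
proof -
  define U where "U = {y::'a. y ^ d = 1}"
  have U_fin: "finite U" "card U \<le> d"
    using finite_roots_of_unity[of d] card_roots_of_unity_le[of d] d by (auto simp: U_def)
  have "(\<lambda>i. G ^ i) ` {..<d} \<subseteq> U"
  proof safe
    fix i have "(G ^ i) ^ d = (G ^ d) ^ i" by (simp add: power_mult[symmetric] mult.commute)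
    then show "G ^ i \<in> U" by (simp add: G U_def)
  qed
  moreover have "card ((\<lambda>i. G ^ i) ` {..<d}) = d" using G by (simp add: card_image)
  ultimately have U: "U = (\<lambda>i. G ^ i) ` {..<d}" using U_fin
    by (metis card_mono card_subset_eq le_antisym)
  have G_mod: "G ^ n = G ^ (n mod d)" for n
  proof -
    have "G ^ n = (G ^ d) ^ (n div d) * G ^ (n mod d)"
      by (simp only: power_mult[symmetric] power_add[symmetric] mult_div_mod_eq)
    then show ?thesis by (simp add: G)
  qed
  \<comment> \<open>The discrete logarithm to base \<open>G\<close>.\<close>
  define ix where "ix y = the_inv_into {..<d} (\<lambda>i. G ^ i) y" for y
  have ix: "ix y < d" "G ^ ix y = y" if "y \<in> U" for y
    using the_inv_into_into[OF G(2), of y] f_the_inv_into_f[OF G(2), of y] that by (auto simp: ix_def U)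
  have ix_pow: "ix (G ^ n) = n mod d" for n
  proof -
    have "ix (G ^ (n mod d)) = n mod d"
      unfolding ix_def using d by (intro the_inv_into_f_f[OF G(2)]) auto
    then show ?thesis using G_mod[of n] by simp
  qed
  have ix_mult: "ix (y * z) = (ix y + ix z) mod d" if "y \<in> U" "z \<in> U" for y z
    using ix_pow[of "ix y + ix z"] ix that by (simp add: power_add)
  define \<zeta> where "\<zeta> = cis (2 * pi / d)"
  have \<zeta>_pow: "\<zeta> ^ n = cis (2 * pi * n / d)" for n
    by (simp add: \<zeta>_def DeMoivre mult_ac)
  have \<zeta>_d: "\<zeta> ^ d = 1" using d by (simp add: \<zeta>_pow)
  have \<zeta>_mod: "(\<zeta> ^ j) ^ n = (\<zeta> ^ j) ^ (n mod d)" for j n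
  proof -
    have "(\<zeta> ^ j) ^ n = (\<zeta> ^ j) ^ (d * (n div d) + n mod d)" by simp
    also have "\<dots> = ((\<zeta> ^ d) ^ j) ^ (n div d) * (\<zeta> ^ j) ^ (n mod d)"
      by (simp only: power_add power_mult[symmetric] mult_ac)
    finally show ?thesis by (simp add: \<zeta>_d)
  qed
  have \<zeta>_neq: "\<zeta> ^ n \<noteq> 1" if "0 < n" "n < d" for n
  proof
    assume "\<zeta> ^ n = 1"
    then have "cis (2 * pi * real n / real d) = cis (2 * pi * real 0 / real d)" by (simp add: \<zeta>_pow)
    then show False
      using inj_onD[OF bij_betw_imp_inj_on[OF bij_betw_roots_unity[of d]], of n 0] that by simp
  qed
  define \<psi> where "\<psi> j y = (if y \<in> U then (\<zeta> ^ j) ^ ix y else 0)" for j y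
  have U_mult: "y * z \<in> U" if "y \<in> U" "z \<in> U" for y z using that by (simp add: U_def power_mult_distrib)
  have psum: "power_residue_sum f q e d (\<psi> j)" if "1 \<le> j" "j < d" for j
  proof
    show "\<psi> j 0 = 0" using d by (simp add: \<psi>_def U_def power_0_left)
    show "\<psi> j 1 = 1" using ix_pow[of 0] by (simp add: \<psi>_def U_def)
    show "\<psi> j (y * z) = \<psi> j y * \<psi> j z" if "y ^ d = 1" "z ^ d = 1" for y z
    proof -
      have yz: "y \<in> U" "z \<in> U" using that by (auto simp: U_def)
      show ?thesis using yz U_mult[OF yz] \<zeta>_mod[of j "ix y + ix z"]
        by (simp add: \<psi>_def ix_mult power_add)
    qed
    show "\<exists>y. y ^ d = 1 \<and> \<psi> j y \<noteq> 1"
      using \<zeta>_neq[of j] that ix_pow[of 1] d G by (intro exI[of _ G]) (auto simp: \<psi>_def U_def)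
  qed (use q d f in auto)
  interpret P: power_residue_sum f q e d "\<psi> 1" by (rule psum) (use d in auto)
  define K where "K = {x::'a. x ^ q = x}"
  define h where "h x = poly f x ^ ((q - 1) div d)" for x
  define m where "m = degree f"
  have K: "finite K" "card K = q" using P.finite_fixed[of 1] P.card_fixed[of 1] by (auto simp: K_def)
  define S where "S j = (\<Sum>x\<in>K. \<psi> j (h x))" for j
  have S_le: "norm (S j) \<le> (real m - 1) * sqrt q" if "1 \<le> j" "j < d" for j
    using power_residue_sum.weil_bound[OF psum[OF that]] f by (simp add: S_def K_def h_def m_def of_nat_diff)
  define N where "N = card {x\<in>K. h x = \<tau>}"
  define z where "z = card {x\<in>K. h x \<notin> U}"
  have "{x\<in>K. h x \<notin> U} \<subseteq> {x. poly f x = 0}"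
    using P.value_root_of_unity[of _ 1] by (auto simp: K_def h_def U_def P.c_def)
  then have "z \<le> card {x. poly f x = 0}"
    unfolding z_def using poly_roots_finite[OF P.f_nz] by (intro card_mono)
  then have z_le: "z \<le> m"
    unfolding m_def using card_poly_roots_bound[OF P.f_nz] by (rule le_trans)
  have "z + card {x\<in>K. h x \<in> U} = card ({x\<in>K. h x \<notin> U} \<union> {x\<in>K. h x \<in> U})"
    unfolding z_def using K by (intro card_Un_disjoint[symmetric]) auto
  also have "{x\<in>K. h x \<notin> U} \<union> {x\<in>K. h x \<in> U} = K" by auto
  finally have zU: "z + card {x\<in>K. h x \<in> U} = q" by (simp add: K)
  have S0: "S 0 = of_nat (card {x\<in>K. h x \<in> U})"
    using K by (simp add: S_def \<psi>_def sum.If_cases Int_def)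
  define t where "t = ix \<tau>"
  have t: "t < d" "G ^ t = \<tau>" using ix[of \<tau>] \<tau> by (auto simp: t_def U_def)
  \<comment> \<open>The exponent d - t stands for -t, as \<zeta> ^ d = 1; the factor is the complex
    conjugate of \<psi> j \<tau>.\<close>
  have orth: "(\<Sum>j<d. (\<zeta> ^ j) ^ (d - t) * \<psi> j y) = (if y = \<tau> then of_nat d else 0)" for y
  proof (cases "y \<in> U")
    case False
    then show ?thesis using \<tau> by (auto simp: \<psi>_def U_def)
  next
    case True
    define w where "w = \<zeta> ^ (d - t + ix y)"
    have "(\<Sum>j<d. (\<zeta> ^ j) ^ (d - t) * \<psi> j y) = (\<Sum>j<d. w ^ j)"
      using True by (intro sum.cong refl) (simp add: \<psi>_def w_def power_mult[symmetric] power_add[symmetric] algebra_simps)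
    also have "\<dots> = (if y = \<tau> then of_nat d else 0)"
    proof (cases "y = \<tau>")
      case True
      then have "w = 1" using t by (simp add: w_def t_def[symmetric] \<zeta>_d)
      then show ?thesis using True by simp
    next
      case False
      have "ix y \<noteq> t" using False t ix[OF True] by auto
      have "w = \<zeta> ^ ((d - t + ix y) mod d)" using \<zeta>_mod[of 1 "d - t + ix y"] by (simp add: w_def)
      moreover have "(d - t + ix y) mod d \<noteq> 0"
      proof
        assume "(d - t + ix y) mod d = 0"
        then obtain k where k: "d - t + ix y = d * k" by (metis mod_0_imp_dvd dvdE)
        have "d - t + ix y < d * 2" "0 < d - t + ix y" using t ix[OF True] by auto
        then have "k = 1" unfolding k by (simp only: mult_less_cancel1 zero_less_mult_iff) auto
        then show False using k t \<open>ix y \<noteq> t\<close> by simp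
      qed
      ultimately have "w \<noteq> 1" using \<zeta>_neq[of "(d - t + ix y) mod d"] d by simp
      moreover have "w ^ d = 1"
        by (metis w_def \<zeta>_d power_mult mult.commute power_one)
      ultimately show ?thesis using False by (simp add: sum_gp_strict)
    qed
    finally show ?thesis .
  qed
  have "of_nat (d * N) = (\<Sum>x\<in>K. if h x = \<tau> then of_nat d else 0 :: complex)"
    using K by (simp add: N_def sum.If_cases Int_def mult.commute)
  also have "\<dots> = (\<Sum>x\<in>K. \<Sum>j<d. (\<zeta> ^ j) ^ (d - t) * \<psi> j (h x))" by (simp add: orth)
  also have "\<dots> = (\<Sum>j<d. \<Sum>x\<in>K. (\<zeta> ^ j) ^ (d - t) * \<psi> j (h x))" by (rule sum.swap)
  also have "\<dots> = (\<Sum>j<d. (\<zeta> ^ j) ^ (d - t) * S j)" by (simp add: S_def sum_distrib_left)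
  also have "{..<d} = insert 0 {1..<d}" using d by auto
  also have "(\<Sum>j\<in>insert 0 {1..<d}. (\<zeta> ^ j) ^ (d - t) * S j) = S 0 + (\<Sum>j\<in>{1..<d}. (\<zeta> ^ j) ^ (d - t) * S j)"
    by simp
  also have "S 0 = of_nat q - of_nat z"
  proof -
    have "(of_nat (z + card {x\<in>K. h x \<in> U}) :: complex) = of_nat q" by (simp only: zU)
    then show ?thesis unfolding S0 by (simp add: algebra_simps)
  qed
  finally have eq: "of_nat (d * N) - of_nat q = (\<Sum>j\<in>{1..<d}. (\<zeta> ^ j) ^ (d - t) * S j) - of_nat z"
    by simp
  have "norm (\<Sum>j\<in>{1..<d}. (\<zeta> ^ j) ^ (d - t) * S j) \<le> of_nat (card {1..<d}) * ((real m - 1) * sqrt q)"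
  proof (rule sum_norm_bound)
    fix j assume "j \<in> {1..<d}"
    then show "norm ((\<zeta> ^ j) ^ (d - t) * S j) \<le> (real m - 1) * sqrt q"
      using S_le[of j] by (simp add: norm_mult norm_power \<zeta>_def)
  qed
  then have "norm (of_nat (d * N) - of_nat q :: complex) \<le> (real d - 1) * ((real m - 1) * sqrt q) + z"
    unfolding eq using d by (intro order_trans[OF norm_triangle_ineq4] add_mono) (auto simp: of_nat_diff)
  also have "norm (of_nat (d * N) - of_nat q :: complex) = norm (of_real (real (d * N) - real q) :: complex)"
    by simp
  also have "\<dots> = \<bar>real (d * N) - real q\<bar>" by (simp only: norm_of_real)
  also have "(real d - 1) * ((real m - 1) * sqrt q) + z \<le> (real d - 1) * (real m * sqrt q) + real m * sqrt q"
  proof (intro add_mono mult_left_mono mult_right_mono)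
    have "real m * 1 \<le> real m * sqrt q" using q(3) by (intro mult_left_mono) auto
    then show "real z \<le> real m * sqrt q" using z_le by linarith
  qed (use d in auto)
  also have "\<dots> = real d * (real m * sqrt q)" by (simp add: algebra_simps)
  finally have "\<bar>real d * (real N - q / d)\<bar> \<le> real d * (real m * sqrt q)" using d by (simp add: field_simps)
  then have "\<bar>real N - q / d\<bar> \<le> real m * sqrt q" using d by (simp add: abs_mult)
  then show ?thesis by (simp add: N_def K_def h_def m_def)
qed

section \<open>A finite field inside its algebraic closure\<close>

lemma finite_field_CHAR:
  assumes "prime p" "CARD('a::{field,finite}) = p ^ k"
  shows "CHAR('a) = p"
proof -
  have "prime CHAR('a)" using finite_imp_CHAR_pos[where ?'a = 'a] prime_CHAR_semidom[where ?'a = 'a] by auto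
  moreover have "CHAR('a) dvd p ^ k" using CHAR_dvd_CARD[where ?'a = 'a] assms(2) by simp
  ultimately show ?thesis using assms(1) by (meson prime_dvd_power primes_dvd_imp_eq)
qed

lemma power_CARD_minus_1:
  fixes x :: "'a::{field,finite}"
  assumes "x \<noteq> 0"
  shows "x ^ (CARD('a) - 1) = 1"
proof -
  have "bij_betw (\<lambda>y. x * y) (UNIV - {0}) (UNIV - {0})"
    by (rule bij_betw_byWitness[of _ "\<lambda>y. y / x"]) (use assms in auto)
  then have "(\<Prod>y\<in>UNIV-{0}. x * y) = (\<Prod>y\<in>UNIV-{0::'a}. y)" by (rule prod.reindex_bij_betw)
  then have "x ^ (CARD('a) - 1) * (\<Prod>y\<in>UNIV-{0::'a}. y) = 1 * (\<Prod>y\<in>UNIV-{0::'a}. y)"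
    by (simp add: prod.distrib card_Diff_singleton)
  then show ?thesis by (subst (asm) mult_right_cancel) auto
qed

lemma power_CARD: "(x :: 'a::{field,finite}) ^ CARD('a) = x"
  using power_CARD_minus_1[of x] power_minus_mult[of "CARD('a)" x]
  by (cases "x = 0") (auto simp: power_0_left)

text \<open>Every element of the finite field satisfies the equation, which has exactly as many
  solutions as the field has elements.\<close>

lemma range_to_ac:
  assumes "prime p" "CARD('a::{field,finite}) = p ^ k" "k \<ge> 1"
  shows "range to_ac = {x::'a alg_closure. x ^ (p ^ k) = x}"
proof -
  have "p ^ 1 \<le> p ^ k" using assms prime_ge_1_nat[OF assms(1)] by (intro power_increasing) auto
  then have "p ^ k \<ge> 2" using prime_ge_2_nat[OF assms(1)] by simp
  then have card: "card {x::'a alg_closure. x ^ (p ^ k) = x} = p ^ k"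
    using assms finite_field_CHAR[OF assms(1,2)] by (intro card_power_fixed[of _ k]) auto
  show ?thesis
  proof (rule card_subset_eq)
    show "finite {x::'a alg_closure. x ^ (p ^ k) = x}"
      using card \<open>p ^ k \<ge> 2\<close> by (intro card_ge_0_finite) linarith
    show "range to_ac \<subseteq> {x::'a alg_closure. x ^ (p ^ k) = x}"
      using power_CARD[where ?'a = 'a] assms(2) by (auto simp flip: to_ac_power)
    show "card (range (to_ac :: 'a \<Rightarrow> _)) = card {x::'a alg_closure. x ^ (p ^ k) = x}"
      by (simp add: card card_image inj_to_ac assms(2))
  qed
qed

lemma poly_map_to_ac: "poly (map_poly to_ac g) (to_ac x) = to_ac (poly g x)"
  by (induction g) (auto simp: map_poly_pCons)

lemma degree_map_to_ac: "degree (map_poly to_ac g) = degree g"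
  by (rule degree_map_poly) auto

text \<open>For d = p - 1 the d-th roots of unity are the nonzero elements of the prime field, and
  raising to the power (p^k - 1) / (p - 1) is the norm to it. A primitive root modulo p generates
  them.\<close>

theorem finite_field_residue_count:
  fixes g :: "'a::{field,finite} poly" and t :: nat
  assumes p: "prime p" "p \<ge> 3" and k: "k \<ge> 1" "CARD('a) = p ^ k"
    and g: "rsquarefree (map_poly to_ac g)" "degree g > 0" and t: "t \<in> {1..p-1}"
  shows "\<bar>real (card {x. poly g x ^ ((p ^ k - 1) div (p - 1)) = of_nat t}) - real (p ^ k) / (real p - 1)\<bar>
      \<le> degree g * sqrt (p ^ k)"
proof -
  define q where "q = p ^ k"
  define d where "d = p - 1"
  note char = finite_field_CHAR[OF p(1) k(2)]
  have "p ^ 1 \<le> q" unfolding q_def using k p by (intro power_increasing) auto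
  then have q3: "q \<ge> 3" using p by simp
  have "[p = 1] (mod d)" using p by (simp add: cong_altdef_nat d_def)
  then have "[p ^ k = 1 ^ k] (mod d)" by (rule cong_pow)
  then have d: "d dvd q - 1" "d \<ge> 2" using p by (auto simp: cong_altdef_nat q_def d_def)
  obtain r where r: "residue_primroot p r" using prime_primitive_root_exists[of p] p by auto
  have "coprime p r" "ord p r = d"
    using r p by (auto simp: residue_primroot_def totient_prime d_def)
  then have cong: "(of_nat r :: 'a alg_closure) ^ i = of_nat r ^ j \<longleftrightarrow> [i = j] (mod d)" for i j
    using order_divides_expdiff[of p r i j] of_nat_eq_iff_cong_CHAR[where ?'a = "'a alg_closure", of "r ^ i" "r ^ j"]
    by (simp add: char)
  have "\<bar>real (card {x. x ^ q = x \<and> poly (map_poly to_ac g) x ^ ((q - 1) div d) = (of_nat t :: 'a alg_closure)}) - q / d\<bar>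
     \<le> degree (map_poly to_ac g) * sqrt q"
  proof (rule power_residue_count[where e = k and G = "of_nat r"])
    show "power_closed q (map_poly to_ac g)"
      using power_CARD[where ?'a = 'a] k(2)
      by (auto simp: power_closed_def coeff_map_poly q_def simp flip: to_ac_power)
    show "(of_nat r :: 'a alg_closure) ^ d = 1" using cong[of d 0] by (simp add: cong_def)
    show "inj_on (\<lambda>i. (of_nat r :: 'a alg_closure) ^ i) {..<d}"
      by (rule inj_onI) (simp add: cong cong_def)
    have "\<not> p dvd t" using t p by (auto dest: dvd_imp_le)
    then have "[t ^ d = 1] (mod p)" unfolding d_def using p by (intro fermat_theorem)
    then have "(of_nat (t ^ d) :: 'a alg_closure) = of_nat 1"
      unfolding of_nat_eq_iff_cong_CHAR by (simp add: char)
    then show "(of_nat t :: 'a alg_closure) ^ d = 1" by simp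
  qed (use p q3 d g in \<open>auto simp: char q_def degree_map_to_ac\<close>)
  also have "{x. x ^ q = x \<and> poly (map_poly to_ac g) x ^ ((q - 1) div d) = (of_nat t :: 'a alg_closure)}
      = to_ac ` {x. poly g x ^ ((q - 1) div d) = of_nat t}"
  proof -
    have "{x. x ^ q = x \<and> poly (map_poly to_ac g) x ^ ((q - 1) div d) = (of_nat t :: 'a alg_closure)}
      = {x \<in> range to_ac. poly (map_poly to_ac g) x ^ ((q - 1) div d) = (of_nat t :: 'a alg_closure)}"
      unfolding range_to_ac[OF p(1) k(2) k(1)] q_def by auto
    also have "\<dots> = to_ac ` {x. poly g x ^ ((q - 1) div d) = of_nat t}"
      by (auto simp: poly_map_to_ac simp flip: to_ac_power to_ac_of_nat)
    finally show ?thesis .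
  qed
  also have "card \<dots> = card {x. poly g x ^ ((q - 1) div d) = of_nat t}"
    by (intro card_image inj_on_subset[OF inj_to_ac]) auto
  finally show ?thesis using p by (simp add: q_def d_def degree_map_to_ac of_nat_diff)
qed

section \<open>The Hasse invariant\<close>

text \<open>The truncated subtractions are harmless: the binomial coefficient vanishes when \<open>(n + b) div 2 > n - b\<close>.\<close>

definition hasse_coeff :: "nat \<Rightarrow> nat \<Rightarrow> nat" where
  "hasse_coeff n b = (if even (n + b) then (n choose b) * ((n - b) choose ((n + b) div 2)) else 0)"

text \<open>In the expansion of (x^3 + A x + B)^n choose B from b factors, x^3 from i and A x from
  the rest: total degree 2 n forces 2 i = n + b. For p = 2 n + 1 this degree is p - 1.\<close>

definition hasse_poly :: "nat \<Rightarrow> 'a::comm_semiring_1 \<Rightarrow> 'a poly" where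
  "hasse_poly n A = (\<Sum>b\<le>n. monom (of_nat (hasse_coeff n b) * A ^ (n - b - (n + b) div 2)) b)"

lemma hasse_coeff_eq_0: "n < b \<Longrightarrow> hasse_coeff n b = 0"
  by (simp add: hasse_coeff_def binomial_eq_0)

lemma coeff_hasse_poly:
  "coeff (hasse_poly n A) b = of_nat (hasse_coeff n b) * A ^ (n - b - (n + b) div 2)"
  by (auto simp: hasse_poly_def coeff_sum hasse_coeff_eq_0 not_le)

lemma degree_hasse_poly: "degree (hasse_poly n A) \<le> n"
  by (intro degree_le) (auto simp: coeff_hasse_poly hasse_coeff_eq_0)

lemma coeff_cubic_power: "coeff ([:B, A, 0, 1:] ^ n) (2 * n) = poly (hasse_poly n A) (B :: 'a::comm_ring_1)"
proof -
  have C: "[:B, A, 0, 1:] = [:B:] + monom 1 1 * (monom 1 2 + [:A:])"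
    by (simp add: monom_altdef numeral_2_eq_2 algebra_simps)
  have inner: "(monom 1 1 * (monom 1 2 + [:A:])) ^ r
      = (\<Sum>i\<le>r. monom (of_nat (r choose i) * A ^ (r - i)) (2 * i + r))" for r
  proof -
    have "(monom 1 1 * (monom 1 2 + [:A:])) ^ r =
        monom 1 r * (\<Sum>i\<le>r. of_nat (r choose i) * monom 1 2 ^ i * [:A:] ^ (r - i))"
      by (simp add: power_mult_distrib binomial_ring monom_power)
    also have "\<dots> = (\<Sum>i\<le>r. monom (of_nat (r choose i) * A ^ (r - i)) (2 * i + r))"
      unfolding sum_distrib_left
      by (intro sum.cong refl)
        (simp add: monom_power of_nat_poly poly_const_pow mult_monom smult_monom mult.commute[of 2] add.commute)
    finally show ?thesis .
  qed
  have "[:B, A, 0, 1:] ^ n = (\<Sum>b\<le>n. of_nat (n choose b) * [:B:] ^ b * (monom 1 1 * (monom 1 2 + [:A:])) ^ (n - b))"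
    unfolding C by (rule binomial_ring)
  also have "\<dots> = (\<Sum>b\<le>n. smult (of_nat (n choose b) * B ^ b) 
      (\<Sum>i\<le>n-b. monom (of_nat ((n - b) choose i) * A ^ (n - b - i)) (2 * i + (n - b))))"
    unfolding inner by (intro sum.cong refl) (simp add: of_nat_poly poly_const_pow mult.commute)
  finally have "coeff ([:B, A, 0, 1:] ^ n) (2 * n) = (\<Sum>b\<le>n. of_nat (n choose b) * B ^ b *
      (\<Sum>i\<le>n-b. if 2 * i + (n - b) = 2 * n then of_nat ((n - b) choose i) * A ^ (n - b - i) else 0))"
    by (simp add: coeff_sum cong: if_cong)
  also have "\<dots> = (\<Sum>b\<le>n. of_nat (hasse_coeff n b) * A ^ (n - b - (n + b) div 2) * B ^ b)"
  proof (intro sum.cong refl)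
    fix b assume b: "b \<in> {..n}"
    have iff: "2 * i + (n - b) = 2 * n \<longleftrightarrow> even (n + b) \<and> i = (n + b) div 2" for i
    proof -
      have "2 * i + (n - b) = 2 * n \<longleftrightarrow> 2 * i = n + b" using b by auto
      moreover have "2 * i = n + b \<longleftrightarrow> even (n + b) \<and> i = (n + b) div 2"
        by (metis dvd_mult_div_cancel dvd_triv_left nonzero_mult_div_cancel_left zero_neq_numeral)
      ultimately show ?thesis by blast
    qed
    have "(\<Sum>i\<le>n-b. if 2 * i + (n - b) = 2 * n then of_nat ((n - b) choose i) * A ^ (n - b - i) else 0)
       = (if even (n + b) then of_nat ((n - b) choose ((n + b) div 2)) * A ^ (n - b - (n + b) div 2) else 0)"
      unfolding iff by (auto simp: not_le binomial_eq_0)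
    then show "of_nat (n choose b) * B ^ b *
      (\<Sum>i\<le>n-b. if 2 * i + (n - b) = 2 * n then of_nat ((n - b) choose i) * A ^ (n - b - i) else 0)
      = of_nat (hasse_coeff n b) * A ^ (n - b - (n + b) div 2) * B ^ b"
      by (simp add: hasse_coeff_def mult_ac)
  qed
  also have "\<dots> = poly (hasse_poly n A) B"
    by (simp add: hasse_poly_def poly_sum poly_monom)
  finally show ?thesis .
qed

lemma coeff_power_CHAR:
  fixes P :: "'a::comm_ring_1 poly"
  assumes "prime CHAR('a)"
  shows "coeff (P ^ CHAR('a)) j = (if CHAR('a) dvd j then coeff P (j div CHAR('a)) ^ CHAR('a) else 0)"
proof -
  define p where "p = CHAR('a)"
  have p: "p > 0" using assms by (simp add: p_def prime_gt_0_nat)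
  have "P ^ p = (\<Sum>i\<le>degree P. monom (coeff P i) i) ^ p" by (simp add: poly_as_sum_of_monoms)
  also have "\<dots> = (\<Sum>i\<le>degree P. monom (coeff P i) i ^ p)"
    using assms by (intro freshmans_dream_sum) (auto simp: p_def)
  also have "coeff \<dots> j = (\<Sum>i\<le>degree P. if i * p = j then coeff P i ^ p else 0)"
    by (simp add: coeff_sum monom_power)
  also have "\<dots> = (if p dvd j then coeff P (j div p) ^ p else 0)"
  proof (cases "p dvd j")
    case True
    then have "i * p = j \<longleftrightarrow> i = j div p" for i using p by auto
    then show ?thesis using True p by (auto simp: coeff_eq_0 not_le power_0_left)
  next
    case False
    then show ?thesis by (auto intro!: sum.neutral)
  qed
  finally show ?thesis by (simp add: p_def)
qed

text \<open>Since \<open>degree D < 2 p - 1\<close>, only one coefficient of \<open>D\<close> is congruent to \<open>p - 1\<close> modulo \<open>p\<close>,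
  so that base-\<open>p\<close> digits do not interact.\<close>

lemma coeff_power_repunit:
  fixes D :: "'a::comm_ring_1 poly"
  assumes p: "prime p" "p = CHAR('a)" and deg: "degree D < 2 * p - 1"
  shows "coeff (D ^ (\<Sum>i<k. p ^ i)) (p ^ k - 1) = coeff D (p - 1) ^ (\<Sum>i<k. p ^ i)"
proof (induction k)
  case (Suc k)
  define N where "N = (\<Sum>i<k. p ^ i)"
  have p2: "p \<ge> 2" using p prime_ge_2_nat by blast
  have N: "(\<Sum>i<Suc k. p ^ i) = Suc (N * p)"
    by (simp add: sum.lessThan_Suc_shift N_def sum_distrib_left[symmetric] mult.commute del: sum.lessThan_Suc)
  define P where "P = D ^ N"
  have "p ^ k \<ge> 1" using p2 by simp
  then have pk: "p ^ Suc k - 1 = (p - 1) + p * (p ^ k - 1)" using p2 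
    by (simp add: algebra_simps)
  have "coeff (D ^ (\<Sum>i<Suc k. p ^ i)) (p ^ Suc k - 1) = coeff (D * P ^ p) (p ^ Suc k - 1)"
    by (simp only: N power_Suc power_mult P_def)
  also have "\<dots> = (\<Sum>i\<le>p ^ Suc k - 1. coeff D i * coeff (P ^ p) (p ^ Suc k - 1 - i))"
    by (rule coeff_mult)
  also have "\<dots> = (\<Sum>i\<in>{p - 1}. coeff D i * coeff (P ^ p) (p ^ Suc k - 1 - i))"
  proof (intro sum.mono_neutral_right ballI)
    show "{p - 1} \<subseteq> {..p ^ Suc k - 1}" unfolding pk by simp
    fix i assume i: "i \<in> {..p ^ Suc k - 1} - {p - 1}"
    show "coeff D i * coeff (P ^ p) (p ^ Suc k - 1 - i) = 0"
    proof (cases "p dvd p ^ Suc k - 1 - i \<and> i \<le> degree D")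
      case True
      then have "p dvd p ^ Suc k - (i + 1)" by simp
      moreover have "1 \<le> p ^ Suc k" using p2 by (intro one_le_power) simp
      then have "i + 1 \<le> p ^ Suc k" using i by (simp del: power_Suc) linarith
      ultimately have "p dvd i + 1" by (metis dvd_diffD1 dvd_triv_left power_Suc)
      then obtain l where l: "i + 1 = p * l" by (elim dvdE)
      have "p * l < p * 2" using True deg l by linarith
      then have "l < 2" by simp
      then have "l = 1" using l by (cases l) auto
      then show ?thesis using l i by auto
    next
      case False
      then show ?thesis using p coeff_power_CHAR[of P "p ^ Suc k - 1 - i"] by (auto simp: coeff_eq_0)
    qed
  qed simp
  also have "\<dots> = coeff D (p - 1) * coeff (P ^ p) (p * (p ^ k - 1))" unfolding pk by simp
  also have "coeff (P ^ p) (p * (p ^ k - 1)) = coeff P (p ^ k - 1) ^ p"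
    using coeff_power_CHAR[of P "p * (p ^ k - 1)"] p p2 by simp
  finally show ?case unfolding N using Suc by (simp add: P_def N_def power_mult)
qed simp

text \<open>Substituting y x for x multiplies the sum by y^j, which kills it unless every nonzero y
  satisfies y^j = 1; for j = 0 it is q = 0. The range reaches 2 (q - 1) because the cubic raised to
  Euler's exponent has degree 3 (q - 1) / 2.\<close>

lemma sum_power_field:
  fixes j :: nat
  assumes "j < 2 * (CARD('a::{field,finite}) - 1)"
  shows "(\<Sum>x\<in>UNIV. (x::'a) ^ j) = (if j = CARD('a) - 1 then -1 else 0)"
proof -
  define q where "q = CARD('a)"
  have "card {0, 1 :: 'a} \<le> q" unfolding q_def by (intro card_mono) auto
  then have q: "q \<ge> 2" by simp
  have q0: "of_nat q = (0 :: 'a)" unfolding q_def using CHAR_dvd_CARD of_nat_eq_0_iff_char_dvd by blast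
  have small: "(\<Sum>x\<in>UNIV. (x::'a) ^ i) = 0" if i: "0 < i" "i < q - 1" for i
  proof -
    have "\<exists>y::'a. y \<noteq> 0 \<and> y ^ i \<noteq> 1"
    proof (rule ccontr)
      assume "\<not> ?thesis"
      then have "UNIV - {0} \<subseteq> {y::'a. y ^ i = 1}" by auto
      then have "card (UNIV - {0 :: 'a}) \<le> card {y::'a. y ^ i = 1}" by (intro card_mono) auto
      also have "\<dots> \<le> i" using i by (intro card_roots_of_unity_le) 
      finally show False using i by (simp add: card_Diff_singleton q_def)
    qed
    then obtain y :: 'a where y: "y \<noteq> 0" "y ^ i \<noteq> 1" by blast
    have "(\<Sum>x\<in>UNIV. x ^ i) = (\<Sum>x\<in>UNIV. (y * x) ^ i)"
      using y by (intro sum.reindex_bij_witness[of _ "\<lambda>x. y * x" "\<lambda>x. x / y"]) auto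
    also have "\<dots> = y ^ i * (\<Sum>x\<in>UNIV. x ^ i)" by (simp add: power_mult_distrib sum_distrib_left)
    finally show ?thesis using y by simp
  qed
  consider "j = 0" | "0 < j" "j < q - 1" | "j = q - 1" | i where "j = q - 1 + i" "0 < i" "i < q - 1"
    using assms by (fold q_def) (metis add_diff_inverse_nat add_less_cancel_left linorder_neqE_nat mult_2 neq0_conv not_less_iff_gr_or_eq zero_less_diff)
  then show ?thesis
  proof cases
    case 1
    then show ?thesis using q q0 by (simp add: q_def)
  next
    case 2
    then show ?thesis using small[of j] by (simp add: q_def)
  next
    case 3
    have "(\<Sum>x\<in>UNIV. (x::'a) ^ j) = (\<Sum>x\<in>UNIV-{0}. x ^ j)"
      using 3 q by (intro sum.mono_neutral_right) auto
    also have "\<dots> = of_nat (q - 1)"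
      using power_CARD_minus_1[where ?'a = 'a] by (simp add: 3 q_def card_Diff_singleton)
    also have "\<dots> = -1" using q q0 by (simp add: of_nat_diff)
    finally show ?thesis using 3 by (simp add: q_def)
  next
    case 4
    have "x ^ j = x ^ i" for x :: 'a
    proof -
      have "x ^ j = x ^ (q - 1) * x ^ i" by (simp only: 4 power_add)
      then show ?thesis using power_CARD_minus_1[of x] 4 by (cases "x = 0") (auto simp: q_def)
    qed
    then show ?thesis using small[of i] 4 by (simp add: q_def)
  qed
qed

lemma sum_poly_field:
  fixes P :: "'a::{field,finite} poly"
  assumes "degree P < 2 * (CARD('a) - 1)"
  shows "(\<Sum>x\<in>UNIV. poly P x) = - coeff P (CARD('a) - 1)"
proof -
  have "(\<Sum>x\<in>UNIV. poly P x) = (\<Sum>i\<le>degree P. \<Sum>x\<in>UNIV. coeff P i * x ^ i)"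
    unfolding poly_altdef by (rule sum.swap)
  also have "\<dots> = (\<Sum>i\<le>degree P. if i = CARD('a) - 1 then - coeff P i else 0)"
    using assms by (intro sum.cong refl) (auto simp: sum_distrib_left[symmetric] sum_power_field)
  also have "\<dots> = - coeff P (CARD('a) - 1)" by (auto simp: coeff_eq_0)
  finally show ?thesis .
qed

text \<open>If w is a square root of v in the algebraic closure, Euler's power of v is w^(q - 1).
  For v \<noteq> 0 it equals 1 exactly when w lies in the field, and otherwise -1, its square being
  1.\<close>

lemma of_nat_card_square_roots:
  fixes v :: "'a::{field,finite}"
  assumes p: "prime p" "p \<ge> 3" "CARD('a) = p ^ k" "k \<ge> 1"
  shows "of_nat (card {y. y ^ 2 = v}) = 1 + v ^ ((CARD('a) - 1) div 2)"
proof -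
  define q where "q = CARD('a)"
  have "odd p" using p prime_odd_nat by auto
  then have "even (q - 1)" using p by (simp add: q_def)
  then have q2: "2 * ((q - 1) div 2) = q - 1" by simp
  have "p ^ 1 \<le> q" unfolding q_def p(3) using p by (intro power_increasing) auto
  then have q3: "q \<ge> 3" using p by simp
  have "\<not> p dvd 2" using p by (auto dest: dvd_imp_le)
  then have two: "(2::'a) \<noteq> 0"
    using of_nat_eq_0_iff_char_dvd[where ?'a = 'a, of 2] finite_field_CHAR[OF p(1,3)] by simp
  obtain w where w: "w ^ 2 = to_ac v" using nth_root_exists[of 2] by auto
  have vw: "to_ac (v ^ ((q - 1) div 2)) = w ^ (q - 1)"
    by (simp add: w[symmetric] power_mult[symmetric] q2 del: One_nat_def)
  consider "v = 0" | "v \<noteq> 0" "w \<in> range to_ac" | "v \<noteq> 0" "w \<notin> range to_ac" by blast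
  then show ?thesis
  proof cases
    case 1
    then have "{y. y ^ 2 = v} = {0}" by auto
    then show ?thesis using 1 q3 by (simp add: q_def[symmetric] power_0_left)
  next
    case 2
    then obtain u where u: "w = to_ac u" by blast
    then have v: "v = u ^ 2" "u \<noteq> 0" using w 2 by (auto simp flip: to_ac_power)
    then have "{y. y ^ 2 = v} = {u, - u}" by (auto simp: power2_eq_iff)
    moreover have "u \<noteq> - u"
    proof
      assume "u = - u"
      then have "2 * u = 0" by (metis add.right_inverse mult_2)
      then show False using two v by simp
    qed
    moreover have "v ^ ((q - 1) div 2) = 1"
      using power_CARD_minus_1[OF v(2)] by (simp only: v(1) power_mult[symmetric] q2 q_def[symmetric])
    ultimately show ?thesis by (simp add: q_def)
  next
    case 3
    have "y ^ 2 \<noteq> v" for y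
    proof
      assume "y ^ 2 = v"
      then have "w ^ 2 = (to_ac y) ^ 2" using w by (simp flip: to_ac_power)
      then have "w = to_ac y \<or> w = to_ac (- y)" by (auto simp: power2_eq_iff)
      then show False using 3 by blast
    qed
    moreover have "v ^ ((q - 1) div 2) = -1"
    proof -
      have "w ^ q \<noteq> w" using range_to_ac[OF p(1,3,4)] 3 p(3) by (auto simp: q_def)
      then have "w ^ (q - 1) \<noteq> 1" using power_minus_mult[of q w] q3 by auto
      then have "v ^ ((q - 1) div 2) \<noteq> 1" using vw by (metis to_ac_1)
      moreover have "(v ^ ((q - 1) div 2)) ^ 2 = 1"
        using power_CARD_minus_1[OF 3(1)] q2 by (simp add: power_mult[symmetric] mult.commute q_def)
      ultimately show ?thesis by (simp add: power2_eq_1_iff)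
    qed
    ultimately show ?thesis by (simp add: q_def)
  qed
qed

lemma power_minus_1_div:
  fixes p :: nat
  assumes "p \<ge> 2"
  shows "(p ^ k - 1) div (p - 1) = (\<Sum>i<k. p ^ i)"
proof -
  have "(\<Sum>i<k. p ^ i) * (p - 1) = p ^ k - 1"
    using assms by (induction k) (auto simp: algebra_simps)
  then show ?thesis using assms by (metis One_nat_def Suc_1 Suc_le_lessD nonzero_mult_div_cancel_right zero_less_diff neq0_conv)
qed

theorem frobenius_trace_eq:
  fixes A B :: "'a::{field,finite}"
  assumes p: "prime p" "p = 2 * n + 1" "n \<ge> 1" "CARD('a) = p ^ k" "k \<ge> 1"
  shows "of_int (frobenius_trace A B) = poly (hasse_poly n A) B ^ ((p ^ k - 1) div (p - 1))"
proof -
  define q where "q = CARD('a)"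
  define C where "C = [:B, A, 0, 1:]"
  define N where "N = (\<Sum>i<k. p ^ i)"
  have char: "CHAR('a) = p" by (rule finite_field_CHAR[OF p(1,4)])
  have N: "N * (p - 1) = q - 1" 
    unfolding N_def q_def p(4) using p(2) by (induction k) (auto simp: algebra_simps)
  have degC: "degree (C ^ r) = 3 * r" for r by (simp add: degree_power_eq C_def)
  have half: "(q - 1) div 2 = n * N" unfolding N[symmetric] using p(2) by simp
  have q1: "q - 1 > 0"
  proof -
    have "card {0, 1 :: 'a} \<le> q" unfolding q_def by (intro card_mono) auto
    then show ?thesis by simp
  qed
  have "ec_points A B = insert None (Some ` (SIGMA x:UNIV. {y. y ^ 2 = poly C x}))"
    unfolding ec_points_def C_def by (auto simp: algebra_simps power3_eq_cube)
  then have "card (ec_points A B) = Suc (\<Sum>x\<in>UNIV. card {y. y ^ 2 = poly C x})"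
    by (simp add: card_image)
  then have "(of_int (frobenius_trace A B) :: 'a) = of_nat q - (\<Sum>x\<in>UNIV. of_nat (card {y. y ^ 2 = poly C x}))"
    by (simp add: frobenius_trace_def q_def)
  also have "\<dots> = of_nat q - (\<Sum>x\<in>UNIV. 1 + poly (C ^ ((q - 1) div 2)) x)"
    using of_nat_card_square_roots[OF p(1) _ p(4,5)] p(2,3) by (simp add: q_def)
  also have "\<dots> = - (\<Sum>x\<in>UNIV. poly (C ^ ((q - 1) div 2)) x)" by (simp add: sum.distrib q_def)
  also have "\<dots> = coeff (C ^ ((q - 1) div 2)) (q - 1)"
    using q1 by (subst sum_poly_field) (auto simp: degC q_def)
  \<comment> \<open>\<open>N\<close> has all base-p digits equal to 1, and the degree 3 n of C^n
    stays below 2 p - 1 = 4 n + 1, as the digit argument requires.\<close>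
  also have "C ^ ((q - 1) div 2) = (C ^ n) ^ N" by (simp only: half power_mult)
  also have "coeff \<dots> (q - 1) = coeff (C ^ n) (p - 1) ^ N"
    unfolding N_def q_def p(4) using p by (intro coeff_power_repunit) (auto simp: char degC)
  also have "coeff (C ^ n) (p - 1) = poly (hasse_poly n A) B"
    using coeff_cubic_power[of B A n] p(2) by (simp add: C_def)
  finally show ?thesis using power_minus_1_div[of p k] p by (simp add: N_def)
qed

section \<open>Separability of the Hasse invariant\<close>

lemma choose_not_dvd: "prime p \<Longrightarrow> n < p \<Longrightarrow> k \<le> n \<Longrightarrow> \<not> p dvd (n choose k)" for p :: nat
  by (metis binomial_fact_lemma dvd_mult2 mult.commute not_less prime_dvd_fact_iff)

lemma hasse_coeff_not_dvd:
  assumes "prime p" "n < p" "even (n + b)" "3 * b \<le> n"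
  shows "\<not> p dvd hasse_coeff n b"
proof -
  have "(n + b) div 2 \<le> n - b" using assms by (auto elim!: evenE)
  then show ?thesis
    using assms choose_not_dvd[of p n b] choose_not_dvd[of p "n - b" "(n + b) div 2"]
    by (auto simp: hasse_coeff_def prime_dvd_mult_iff)
qed

text \<open>The recurrence below is the hypergeometric differential equation of the Hasse invariant;
  its characteristic \<open>p\<close> form results from \<open>2 n = - 1\<close>.\<close>

lemma hasse_coeff_recurrence:
  assumes "2 * i = n + b" "a + b + i = n"
  shows "(b + 1) * (b + 2) * (i + 1) * hasse_coeff n (b + 2) = a * (a - 1) * (a - 2) * hasse_coeff n b"
proof -
  have ev: "even (n + b)" "(n + b) div 2 = i" "n - b = a + i" "b \<le> n"
    using assms by (auto simp flip: assms(1))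
  \<comment> \<open>The coefficient is the multinomial n! / (b! i! a!). Passing from b to b + 2
    replaces i by i + 1 and a by a - 3, and the quotient of the two multinomials is the
    recurrence.\<close>
  have E: "fact b * fact i * fact a * hasse_coeff n b = (fact n :: nat)"
  proof -
    have "fact b * fact (a + i) * (n choose b) = (fact n :: nat)"
      using binomial_fact_lemma[of b n] ev by simp
    moreover have "fact i * fact a * ((a + i) choose i) = (fact (a + i) :: nat)"
      using binomial_fact_lemma[of i "a + i"] by simp
    moreover have "fact b * fact i * fact a * hasse_coeff n b
        = fact b * (fact i * fact a * ((a + i) choose i)) * (n choose b)"
      by (simp only: hasse_coeff_def ev if_True mult_ac)
    ultimately show ?thesis by simp
  qed
  show ?thesis
  proof (cases "a \<ge> 3")
    case False
    have "hasse_coeff n (b + 2) = 0"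
    proof -
      have "n - (b + 2) < (n + (b + 2)) div 2" using False assms ev by linarith
      then show ?thesis by (simp add: hasse_coeff_def binomial_eq_0)
    qed
    moreover have "a * (a - 1) * (a - 2) = 0" using False by auto
    ultimately show ?thesis by simp
  next
    case True
    then obtain a' where a: "a = a' + 3" by (metis add.commute le_Suc_ex)
    have ev': "even (n + (b + 2))" "(n + (b + 2)) div 2 = i + 1" "n - (b + 2) = a' + (i + 1)" "b + 2 \<le> n"
      using assms a ev by auto
    have E': "fact (b + 2) * fact (i + 1) * fact a' * hasse_coeff n (b + 2) = (fact n :: nat)"
    proof -
      have "fact (b + 2) * fact (a' + (i + 1)) * (n choose (b + 2)) = (fact n :: nat)"
        using binomial_fact_lemma[of "b + 2" n] ev' by simp
      moreover have "fact (i + 1) * fact a' * ((a' + (i + 1)) choose (i + 1)) = (fact (a' + (i + 1)) :: nat)"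
        using binomial_fact_lemma[of "i + 1" "a' + (i + 1)"] by simp
      moreover have "fact (b + 2) * fact (i + 1) * fact a' * hasse_coeff n (b + 2)
          = fact (b + 2) * (fact (i + 1) * fact a' * ((a' + (i + 1)) choose (i + 1))) * (n choose (b + 2))"
        by (simp only: hasse_coeff_def ev' if_True mult_ac)
      ultimately show ?thesis by (simp only:)
    qed
    have "(fact b * fact i * fact a') * ((b + 1) * (b + 2) * (i + 1) * hasse_coeff n (b + 2))
        = (fact b * fact i * fact a') * (a * (a - 1) * (a - 2) * hasse_coeff n b)"
      using E E' unfolding a by (simp add: fact_reduce numeral_3_eq_3 algebra_simps)
    then show ?thesis by (subst (asm) mult_left_cancel) auto
  qed
qed

lemma of_nat_neq_0_CHAR: "0 < j \<Longrightarrow> j < CHAR('a) \<Longrightarrow> of_nat j \<noteq> (0 :: 'a::semiring_1)"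
  by (auto simp: of_nat_eq_0_iff_char_dvd dest: dvd_imp_le)

text \<open>From 2 n = -1 one gets 4 (i + 1) = 2 b + 3 and 4 (a - 2) = -3 (2 b + 3) in the field.
  The common factor 2 b + 3 is nonzero because 3 b \<le> n makes it smaller than p; cancelling it
  leaves the factors 6 b + 1 and 6 b + 5. Outside this range, or for the wrong parity, both
  coefficients vanish.\<close>

lemma coeff_hasse_poly_recurrence:
  fixes A :: "'a::field"
  assumes p: "prime p" "CHAR('a) = p" "p = 2 * n + 1" "n \<ge> 2"
  shows "16 * A ^ 3 * of_nat ((b + 1) * (b + 2)) * coeff (hasse_poly n A) (b + 2)
    + 3 * (6 * of_nat b + 1) * (6 * of_nat b + 5) * coeff (hasse_poly n A) b = 0"
proof (cases "even (n + b) \<and> 3 * b \<le> n")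
  case False
  then have "hasse_coeff n b = 0 \<and> hasse_coeff n (b + 2) = 0"
  proof (cases "even (n + b)")
    case True
    then have b: "n < 3 * b" using False by simp
    obtain i where i: "n + b = 2 * i" using True by (elim evenE)
    then have "(n + b) div 2 = i" "(n + (b + 2)) div 2 = i + 1" by simp_all
    moreover have "n - b < i" "n - (b + 2) < i + 1" using i b by linarith+
    ultimately have "n - b < (n + b) div 2" "n - (b + 2) < (n + (b + 2)) div 2" by simp_all
    then show ?thesis by (simp add: hasse_coeff_def binomial_eq_0)
  qed (auto simp: hasse_coeff_def)
  then show ?thesis by (simp add: coeff_hasse_poly)
next
  case True
  define i where "i = (n + b) div 2"
  define a where "a = n - b - i"
  have i: "2 * i = n + b" using True by (simp add: i_def)
  have a: "a + b + i = n" using True i by (simp add: a_def)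
  have 2: "2 * (of_nat n :: 'a) = -1"
  proof -
    have "of_nat (2 * n + 1) = (0 :: 'a)" using p of_nat_CHAR by metis
    then show ?thesis by (simp add: add_eq_0_iff)
  qed
  define E E' where "E = (of_nat (hasse_coeff n b) :: 'a)" and "E' = (of_nat (hasse_coeff n (b + 2)) :: 'a)"
  define \<beta> \<alpha> \<iota> \<nu> where "\<beta> = (of_nat b :: 'a)" and "\<alpha> = (of_nat a :: 'a)" and "\<iota> = (of_nat i :: 'a)" and "\<nu> = (of_nat n :: 'a)"
  have \<iota>: "4 * \<iota> = 2 * \<beta> - 1"
  proof -
    have "2 * \<iota> = \<nu> + \<beta>" unfolding \<iota>_def \<nu>_def \<beta>_def using i by (metis of_nat_add of_nat_mult of_nat_numeral)
    then have "2 * (2 * \<iota>) = 2 * \<nu> + 2 * \<beta>" by (simp add: algebra_simps)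
    then show ?thesis using 2 by (simp add: \<nu>_def)
  qed
  have \<alpha>: "4 * \<alpha> = - 1 - 6 * \<beta>"
  proof -
    have \<nu>: "\<nu> = \<alpha> + \<beta> + \<iota>" unfolding \<iota>_def \<nu>_def \<beta>_def \<alpha>_def using a by (metis of_nat_add)
    have "4 * \<alpha> = 2 * (2 * \<nu>) - 4 * \<beta> - 4 * \<iota>" unfolding \<nu> by (simp add: algebra_simps)
    also have "\<dots> = - 1 - 6 * \<beta>" unfolding \<iota> 2[folded \<nu>_def] by (simp add: algebra_simps)
    finally show ?thesis .
  qed
  have rec: "(\<beta> + 1) * (\<beta> + 2) * (\<iota> + 1) * E' = \<alpha> * (\<alpha> - 1) * (\<alpha> - 2) * E"
  proof -
    have "(of_nat (a * (a - 1) * (a - 2)) :: 'a) = \<alpha> * (\<alpha> - 1) * (\<alpha> - 2)"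
      by (cases a; cases "a - 1") (auto simp: \<alpha>_def of_nat_diff algebra_simps)
    moreover have "(of_nat ((b + 1) * (b + 2) * (i + 1) * hasse_coeff n (b + 2)) :: 'a) =
        of_nat (a * (a - 1) * (a - 2) * hasse_coeff n b)"
      using hasse_coeff_recurrence[OF i a] by simp
    moreover have "(of_nat ((b + 1) * (b + 2) * (i + 1) * hasse_coeff n (b + 2)) :: 'a)
        = (\<beta> + 1) * (\<beta> + 2) * (\<iota> + 1) * E'"
      by (simp only: of_nat_mult of_nat_add of_nat_1 of_nat_numeral E'_def \<beta>_def \<iota>_def)
    moreover have "(of_nat (a * (a - 1) * (a - 2) * hasse_coeff n b) :: 'a) = of_nat (a * (a - 1) * (a - 2)) * E"
      unfolding E_def by (rule of_nat_mult)
    ultimately show ?thesis by (simp only:)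
  qed
  have "(2 * \<beta> + 3) * (16 * (\<beta> + 1) * (\<beta> + 2) * E') = 16 * ((\<beta> + 1) * (\<beta> + 2) * (4 * \<iota> + 4) * E')"
    unfolding \<iota> by (simp add: algebra_simps)
  also have "\<dots> = 64 * ((\<beta> + 1) * (\<beta> + 2) * (\<iota> + 1) * E')" by (simp add: algebra_simps)
  also have "\<dots> = (4 * \<alpha>) * (4 * \<alpha> - 4) * (4 * \<alpha> - 8) * E" unfolding rec by (simp add: algebra_simps)
  also have "\<dots> = (2 * \<beta> + 3) * (- 3 * (6 * \<beta> + 1) * (6 * \<beta> + 5) * E)" unfolding \<alpha> by (simp add: algebra_simps)
  finally have "(2 * \<beta> + 3) * (16 * (\<beta> + 1) * (\<beta> + 2) * E') = (2 * \<beta> + 3) * (- 3 * (6 * \<beta> + 1) * (6 * \<beta> + 5) * E)" .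
  moreover have "2 * \<beta> + 3 \<noteq> 0"
    using of_nat_neq_0_CHAR[of "2 * b + 3", where ?'a = 'a] True p by (simp add: \<beta>_def)
  ultimately have main: "16 * (\<beta> + 1) * (\<beta> + 2) * E' = - 3 * (6 * \<beta> + 1) * (6 * \<beta> + 5) * E"
    by (rule mult_left_cancel[THEN iffD1, rotated])
  have c: "coeff (hasse_poly n A) b = E * A ^ a"
    by (simp add: coeff_hasse_poly E_def a_def i_def)
  have c': "A ^ 3 * coeff (hasse_poly n A) (b + 2) = E' * A ^ a"
  proof (cases "a \<ge> 3")
    case True
    have "n - (b + 2) - (n + (b + 2)) div 2 = a - 3" using i a by simp
    then show ?thesis using True by (simp add: coeff_hasse_poly E'_def power_add[symmetric])
  next
    case False
    have "n - (b + 2) < (n + (b + 2)) div 2" using False i a by linarith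
    then have "hasse_coeff n (b + 2) = 0" by (simp add: hasse_coeff_def binomial_eq_0)
    then show ?thesis by (simp add: coeff_hasse_poly E'_def)
  qed
  have "16 * A ^ 3 * of_nat ((b + 1) * (b + 2)) * coeff (hasse_poly n A) (b + 2)
      = 16 * (\<beta> + 1) * (\<beta> + 2) * (A ^ 3 * coeff (hasse_poly n A) (b + 2))"
    by (simp add: \<beta>_def algebra_simps)
  also have "\<dots> = (16 * (\<beta> + 1) * (\<beta> + 2) * E') * A ^ a" unfolding c' by simp
  also have "\<dots> = - (3 * (6 * \<beta> + 1) * (6 * \<beta> + 5) * coeff (hasse_poly n A) b)" unfolding main c by (simp add: algebra_simps)
  finally show ?thesis by (simp add: \<beta>_def)
qed

text \<open>The constants reflect 3 (6 b + 1) (6 b + 5) = 108 b (b - 1) + 216 b + 15. The leading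
  coefficient is 4 (4 A^3 + 27 B^2), so the equation is singular exactly at the singular
  cubics.\<close>

lemma hasse_poly_differential_equation:
  fixes A :: "'a::field"
  assumes p: "prime p" "CHAR('a) = p" "p = 2 * n + 1" "n \<ge> 2"
  defines "f \<equiv> hasse_poly n A"
  shows "[:16 * A ^ 3, 0, 108:] * pderiv (pderiv f) + [:0, 216:] * pderiv f + smult 15 f = 0"
proof (rule poly_eqI)
  fix b
  have "coeff ([:16 * A ^ 3, 0, 108:] * pderiv (pderiv f) + [:0, 216:] * pderiv f + smult 15 f) b
    = 16 * A ^ 3 * of_nat ((b + 1) * (b + 2)) * coeff f (b + 2)
    + 3 * (6 * of_nat b + 1) * (6 * of_nat b + 5) * coeff f b"
  proof (cases b)
    case 0
    then show ?thesis by (simp add: coeff_pderiv numeral_2_eq_2 algebra_simps)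
  next
    case (Suc c)
    then show ?thesis by (cases c) (simp_all add: coeff_pderiv coeff_pCons algebra_simps)
  qed
  also have "\<dots> = 0" unfolding f_def by (rule coeff_hasse_poly_recurrence[OF p])
  finally show "coeff ([:16 * A ^ 3, 0, 108:] * pderiv (pderiv f) + [:0, 216:] * pderiv f + smult 15 f) b = coeff 0 b"
    by simp
qed

text \<open>After shifting a hypothetical double root x to 0, the differential equation becomes a
  recurrence for the Taylor coefficients whose first two terms vanish. Its leading factors are
  invertible for indices below p, and the degree is at most n < p, so the whole polynomial would be
  0.\<close>

lemma rsquarefree_hasse_poly:
  fixes A :: "'a::field"
  assumes p: "prime p" "CHAR('a) = p" "p = 2 * n + 1" "n \<ge> 2" and A: "A \<noteq> 0"
    and nz: "hasse_poly n A \<noteq> 0"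
  shows "rsquarefree (hasse_poly n A)"
proof (rule rsquarefreeI[OF nz], rule notI)
  fix x assume x: "poly (hasse_poly n A) x = 0" "poly (pderiv (hasse_poly n A)) x = 0"
  define f where "f = hasse_poly n A"
  define F where "F = pcompose f [:x, 1:]"
  define c where "c = 16 * A ^ 3 + 108 * x ^ 2"
  have num: "of_nat j \<noteq> (0 :: 'a)" if "0 < j" "j < p" for j using of_nat_neq_0_CHAR[of j, where ?'a = 'a] that p by simp
  have 2: "(2 :: 'a) \<noteq> 0" and 3: "(3 :: 'a) \<noteq> 0" using num[of 2] num[of 3] p by auto
  have 16: "(16 :: 'a) \<noteq> 0"
  proof -
    have "(16 :: 'a) = 2 ^ 4" by simp
    then show ?thesis using 2 by (metis power_not_zero)
  qed
  have 216: "(216 :: 'a) \<noteq> 0"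
  proof -
    have "(216 :: 'a) = 2 ^ 3 * 3 ^ 3" by simp
    then show ?thesis using 2 3 by (metis mult_eq_0_iff power_not_zero)
  qed
  have dF: "pderiv F = pcompose (pderiv f) [:x, 1:]" "pderiv (pderiv F) = pcompose (pderiv (pderiv f)) [:x, 1:]"
    by (simp_all add: F_def pderiv_pcompose pderiv_pCons)
  have "pcompose ([:16 * A ^ 3, 0, 108:] * pderiv (pderiv f) + [:0, 216:] * pderiv f + smult 15 f) [:x, 1:] = 0"
    unfolding f_def hasse_poly_differential_equation[OF p] by simp
  then have ode: "[:c, 216 * x, 108:] * pderiv (pderiv F) + [:216 * x, 216:] * pderiv F + smult 15 F = 0"
    unfolding pcompose_add pcompose_mult pcompose_smult dF[symmetric] F_def[symmetric]
    by (simp add: pcompose_pCons c_def power2_eq_square algebra_simps)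
  have rec: "c * of_nat ((j + 1) * (j + 2)) * coeff F (j + 2) + 216 * x * of_nat ((j + 1) ^ 2) * coeff F (j + 1)
      + (108 * of_nat (j * (j + 1)) + 15) * coeff F j = 0" for j
  proof -
    have "coeff ([:c, 216 * x, 108:] * pderiv (pderiv F) + [:216 * x, 216:] * pderiv F + smult 15 F) j =
      c * of_nat ((j + 1) * (j + 2)) * coeff F (j + 2) + 216 * x * of_nat ((j + 1) ^ 2) * coeff F (j + 1)
      + (108 * of_nat (j * (j + 1)) + 15) * coeff F j"
    proof (cases j)
      case 0
      then show ?thesis by (simp add: coeff_pderiv numeral_2_eq_2 algebra_simps)
    next
      case (Suc l)
      then show ?thesis by (cases l) (simp_all add: coeff_pderiv coeff_pCons power2_eq_square algebra_simps)
    qed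
    then show ?thesis by (simp only: ode coeff_0)
  qed
  have F0: "coeff F 0 = 0" "coeff F 1 = 0"
  proof -
    have "coeff F 0 = poly F 0" "coeff F 1 = poly (pderiv F) 0"
      by (simp_all add: poly_0_coeff_0 coeff_pderiv)
    then show "coeff F 0 = 0" "coeff F 1 = 0"
      using x by (simp_all add: dF) (simp_all add: F_def f_def poly_pcompose)
  qed
  have small: "j < p \<Longrightarrow> coeff F j = 0" for j
  proof (induction j rule: less_induct)
    case (less j)
    show ?case
    proof (cases "j < 2")
      case True
      then have "j = 0 \<or> j = 1" by auto
      then show ?thesis using F0 by auto
    next
      case False
      then obtain l where l: "j = l + 2" by (metis add.commute le_Suc_ex not_less)
      show ?thesis
      proof (cases "c = 0")
        case True
        \<comment> \<open>At a singular point of the equation the recurrence drops to first order,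
          with leading factor 216 x j^2; vanishing of \<open>c\<close> together with A \<noteq> 0
          keeps x away from 0.\<close>
        have "x \<noteq> 0" using True 16 A by (auto simp: c_def)
        have "216 * x * of_nat (j ^ 2) * coeff F j = 0"
          using rec[of "l + 1"] less.IH[of "l + 1"] less.prems True l by simp
        then show ?thesis using 216 \<open>x \<noteq> 0\<close> num[of j] less.prems l by simp
      next
        case False
        have "c * of_nat ((l + 1) * (l + 2)) * coeff F j = 0"
          using rec[of l] less.IH[of "l + 1"] less.IH[of l] less.prems l by simp
        then show ?thesis using False num[of "l + 1"] num[of "l + 2"] less.prems l
          by (simp only: of_nat_mult mult_eq_0_iff) auto
      qed
    qed
  qed
  have "degree F \<le> n" using degree_hasse_poly[of n A] by (simp add: F_def f_def degree_pcompose)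
  then have "F = 0" using small p by (metis le_add1 le_imp_less_Suc leading_coeff_0_iff less_le_trans mult_2 add.commute plus_1_eq_Suc le_less_trans)
  then have "f = 0" unfolding F_def by (rule pcompose_eq_0) simp
  then show False using nz by (simp add: f_def)
qed

section \<open>Equidistribution of the trace\<close>

text \<open>A vanishing discriminant means that the cubic is (x - t)^2 (x + 2 t), which expands to
  x^3 - 3 t^2 x + 2 t^3. For A \<noteq> 0 the double root is the rational expression -3 B / (2 A),
  so it lies in the field itself.\<close>

lemma singular_pairs_eq:
  fixes A B :: "'a::field"
  assumes "(2::'a) \<noteq> 0" "(3::'a) \<noteq> 0"
  shows "4 * A ^ 3 + 27 * B ^ 2 = 0 \<longleftrightarrow> (\<exists>t. A = -3 * t ^ 2 \<and> B = 2 * t ^ 3)"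
proof
  have four: "(4::'a) = 2 * 2" and "(27::'a) = 3 ^ 3" by simp_all
  then have nz: "(4::'a) \<noteq> 0" "(27::'a) \<noteq> 0" using assms by (metis mult_eq_0_iff, metis power_not_zero)
  assume eq: "4 * A ^ 3 + 27 * B ^ 2 = 0"
  then have B2: "27 * B ^ 2 = - (4 * A ^ 3)" by (simp add: add_eq_0_iff)
  show "\<exists>t. A = -3 * t ^ 2 \<and> B = 2 * t ^ 3"
  proof (cases "A = 0")
    case True
    then show ?thesis using eq nz by (intro exI[of _ 0]) simp
  next
    case False
    define t where "t = - (3 * B) / (2 * A)"
    have t: "2 * A * t = - (3 * B)" using False assms by (simp add: t_def)
    have "4 * A ^ 2 * (- 3 * t ^ 2) = - 3 * (2 * A * t) ^ 2" by (simp add: power2_eq_square)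
    also have "\<dots> = - (27 * B ^ 2)" unfolding t by (simp add: power2_eq_square)
    also have "\<dots> = 4 * A ^ 2 * A" unfolding B2 by (simp add: power2_eq_square power3_eq_cube)
    finally have A: "- 3 * t ^ 2 = A" using False nz by (subst (asm) mult_left_cancel) auto
    have "3 * (2 * t ^ 3) = - 2 * t * (- 3 * t ^ 2)" by (simp add: power2_eq_square power3_eq_cube)
    also have "\<dots> = 3 * B" unfolding A using t by (simp add: algebra_simps)
    finally have "2 * t ^ 3 = B" using assms by (subst (asm) mult_left_cancel) auto
    then show ?thesis using A by blast
  qed
next
  assume "\<exists>t. A = -3 * t ^ 2 \<and> B = 2 * t ^ 3"
  then obtain t where "A = -3 * t ^ 2" "B = 2 * t ^ 3" by blast
  then show "4 * A ^ 3 + 27 * B ^ 2 = 0" by (simp add: power_mult_distrib power_mult[symmetric] power3_eq_cube[of "-3"])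
qed

lemma card_singular_pairs:
  assumes "(2::'a::{field,finite}) \<noteq> 0" "(3::'a) \<noteq> 0"
  shows "card (- ec_pairs :: ('a \<times> 'a) set) = CARD('a)"
proof -
  have "- ec_pairs = (\<lambda>t::'a. (-3 * t ^ 2, 2 * t ^ 3)) ` UNIV"
    using singular_pairs_eq[OF assms] by (auto simp: ec_pairs_def)
  moreover have "inj (\<lambda>t::'a. (-3 * t ^ 2, 2 * t ^ 3))"
  proof (rule injI)
    fix s t :: 'a assume "(-3 * s ^ 2, 2 * s ^ 3) = (-3 * t ^ 2, 2 * t ^ 3)"
    then have st: "s ^ 2 = t ^ 2" "s ^ 3 = t ^ 3" using assms by auto
    then have "s * t ^ 2 = t * t ^ 2" by (metis power2_eq_square power3_eq_cube mult.assoc)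
    then show "s = t" using st by (cases "t = 0") auto
  qed
  ultimately show ?thesis by (simp add: card_image)
qed

lemma map_poly_hasse_poly: "map_poly to_ac (hasse_poly n A) = hasse_poly n (to_ac A)"
  by (intro poly_eqI) (simp add: coeff_map_poly coeff_hasse_poly)

text \<open>For p \<ge> 7 each slice with A \<noteq> 0 contributes an error of at most n sqrt q. The
  slice A = 0 is estimated trivially and accounts for the summand q.\<close>

theorem hasse_residue_count:
  fixes t n :: nat
  assumes p: "prime p" "p \<ge> 5" "p = 2 * n + 1" and k: "k \<ge> 1" "CARD('a::{field,finite}) = p ^ k"
    and t: "t \<in> {1..p-1}"
  defines "q \<equiv> real (p ^ k)"
  shows "\<bar>real (card {(A::'a, B). poly (hasse_poly n A) B ^ ((p ^ k - 1) div (p - 1)) = of_nat t}) - q ^ 2 / (real p - 1)\<bar>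
    \<le> n * (q * sqrt q) + q"
proof -
  define c where "c = (p ^ k - 1) div (p - 1)"
  define N where "N A = card {B. poly (hasse_poly n A) B ^ c = of_nat t}" for A :: 'a
  define b where "b = q / (real p - 1)"
  have char: "CHAR('a) = p" by (rule finite_field_CHAR[OF p(1) k(2)])
  have q_pos: "q \<ge> 1" unfolding q_def using p by simp
  have b: "0 \<le> b" "b \<le> q" using p q_pos by (auto simp: b_def field_simps)
  have "{(A::'a, B). poly (hasse_poly n A) B ^ c = of_nat t}
      = (SIGMA A:UNIV. {B. poly (hasse_poly n A) B ^ c = of_nat t})" by auto
  then have card: "card {(A::'a, B). poly (hasse_poly n A) B ^ c = of_nat t} = (\<Sum>A\<in>UNIV. N A)"
    by (simp add: N_def)
  have qb: "q ^ 2 / (real p - 1) = (\<Sum>A\<in>(UNIV::'a set). b)"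
    by (simp add: b_def k q_def power2_eq_square)
  consider "n = 2" | "n \<ge> 3" using p(2,3) by linarith
  then have "\<bar>real (\<Sum>A\<in>UNIV. N A) - (\<Sum>A\<in>(UNIV::'a set). b)\<bar> \<le> n * (q * sqrt q) + q"
  proof cases
    case 1
    have "hasse_coeff 2 b = (if b = 0 then 2 else 0)" for b
    proof -
      consider "b = 0" | "b = 1" | "b = 2" | "b > 2" by linarith
      then show ?thesis by cases (auto simp: hasse_coeff_eq_0 hasse_coeff_def binomial_eq_0)
    qed
    then have hp: "hasse_poly n A = [:2 * A:]" for A :: 'a
      unfolding 1 by (intro poly_eqI) (auto simp: coeff_hasse_poly coeff_pCons split: nat.split)
    have "(2 :: 'a alg_closure) \<noteq> 0"
      using of_nat_neq_0_CHAR[of 2, where ?'a = "'a alg_closure"] char p by simp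
    \<comment> \<open>For p = 5 the values equidistribute in A instead of B: the residue count is
      applied to 2 X, and every admissible A brings a full slice of q values of B.\<close>
    then have "rsquarefree (map_poly to_ac [:0, 2 :: 'a:])"
      by (intro rsquarefreeI) (auto simp: map_poly_pCons pderiv_pCons)
    moreover have "degree [:0, 2 :: 'a:] = 1"
      using of_nat_neq_0_CHAR[of 2, where ?'a = 'a] char p by simp
    ultimately have *: "\<bar>real (card {A::'a. poly [:0, 2:] A ^ c = of_nat t}) - b\<bar> \<le> sqrt q"
      using finite_field_residue_count[OF p(1) _ k, of "[:0, 2:]" t] p t by (simp add: c_def b_def q_def)
    have "(\<Sum>A\<in>UNIV. N A) = card {A::'a. poly [:0, 2:] A ^ c = of_nat t} * p ^ k"
    proof -
      have "N A = (if poly [:0, 2:] A ^ c = of_nat t then p ^ k else 0)" for A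
        by (simp add: N_def hp k mult.commute)
      then show ?thesis by (simp add: sum.If_cases)
    qed
    then have "real (\<Sum>A\<in>UNIV. N A) - (\<Sum>A\<in>(UNIV::'a set). b)
        = q * (real (card {A::'a. poly [:0, 2:] A ^ c = of_nat t}) - b)"
      by (simp add: q_def k algebra_simps)
    then have "\<bar>real (\<Sum>A\<in>UNIV. N A) - (\<Sum>A\<in>(UNIV::'a set). b)\<bar>
        = q * \<bar>real (card {A::'a. poly [:0, 2:] A ^ c = of_nat t}) - b\<bar>"
      using q_pos by (simp add: abs_mult)
    also have "\<dots> \<le> q * sqrt q" using * q_pos by (intro mult_left_mono) auto
    also have "\<dots> \<le> n * (q * sqrt q) + q" using 1 q_pos by simp
    finally show ?thesis .
  next
    case 2
    have N_le: "\<bar>real (N A) - b\<bar> \<le> n * sqrt q" if A: "A \<noteq> 0" for A :: 'a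
    proof -
      \<comment> \<open>The least positive degree of the right parity. Among n \<ge> 3 the condition
        3 j \<le> n fails only for n = 4, that is p = 9, which is not prime.\<close>
      define j :: nat where "j = (if odd n then 1 else 2)"
      have "n \<noteq> 4"
      proof
        assume "n = 4"
        then have "p = 3 * 3" using p by simp
        then show False using p(1) by (metis prime_product less_numeral_extra(1) numeral_eq_one_iff semiring_norm(85,86) verit_eq_simplify(9))
      qed
      then have j: "even (n + j)" "3 * j \<le> n" "j > 0" using 2 by (auto simp: j_def elim!: evenE)
      have "\<not> CHAR('a) dvd hasse_coeff n j"
        unfolding char using p j by (intro hasse_coeff_not_dvd) auto
      then have "coeff (hasse_poly n A) j \<noteq> 0"
        using A by (simp add: coeff_hasse_poly of_nat_eq_0_iff_char_dvd)
      then have deg: "degree (hasse_poly n A) > 0" using j le_degree by fastforce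
      have "hasse_poly n (to_ac A) \<noteq> 0"
        using deg by (auto simp flip: map_poly_hasse_poly simp: map_poly_eq_0_iff)
      then have "rsquarefree (map_poly to_ac (hasse_poly n A))"
        unfolding map_poly_hasse_poly using p A 2
        by (intro rsquarefree_hasse_poly[OF p(1) _ p(3)]) (auto simp: char)
      then have "\<bar>real (N A) - b\<bar> \<le> degree (hasse_poly n A) * sqrt q"
        using finite_field_residue_count[OF p(1) _ k _ deg t] p by (simp add: N_def b_def q_def c_def)
      also have "\<dots> \<le> n * sqrt q" using degree_hasse_poly[of n A] q_pos by (intro mult_right_mono) auto
      finally show ?thesis .
    qed
    have N0: "\<bar>real (N 0) - b\<bar> \<le> q"
    proof -
      have "N 0 \<le> card (UNIV :: 'a set)" unfolding N_def by (intro card_mono) auto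
      then have "real (N 0) \<le> q" by (simp add: q_def k)
      then show ?thesis using b by linarith
    qed
    have "\<bar>real (\<Sum>A\<in>UNIV. N A) - (\<Sum>A\<in>(UNIV::'a set). b)\<bar> = \<bar>\<Sum>A\<in>UNIV. real (N A) - b\<bar>"
      by (simp add: sum_subtractf)
    also have "\<dots> \<le> (\<Sum>A\<in>UNIV. \<bar>real (N A) - b\<bar>)" by (rule sum_abs)
    also have "\<dots> = \<bar>real (N 0) - b\<bar> + (\<Sum>A\<in>UNIV-{0}. \<bar>real (N A) - b\<bar>)"
      by (subst sum.remove[of UNIV 0]) auto
    also have "\<dots> \<le> q + (\<Sum>A\<in>UNIV-{0::'a}. n * sqrt q)"
      using N0 N_le by (intro add_mono sum_mono) auto
    also have "(\<Sum>A\<in>UNIV-{0::'a}. n * sqrt q) \<le> (\<Sum>A\<in>(UNIV::'a set). n * sqrt q)"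
      using q_pos by (intro sum_mono2) auto
    finally show ?thesis by (simp add: k q_def algebra_simps)
  qed
  then show ?thesis unfolding card[symmetric] qb[symmetric] c_def by simp
qed

theorem theorem10p2:
  fixes p k :: nat and t :: int
  assumes "prime p" and "p \<ge> 5" and "k \<ge> 1"
    and "CARD('a::{field,finite}) = p ^ k"
    and "t \<in> {1..int p - 1}"
  shows "int (card (ec_pairs :: ('a \<times> 'a) set)) = int p ^ (2 * k) - int p ^ k
    \<and> \<bar>real (card (ec_pairs_trace p t :: ('a \<times> 'a) set))
          - real (card (ec_pairs :: ('a \<times> 'a) set)) / (real p - 1)\<bar>
        \<le> 3 * real p powr (3 * real k / 2 + 1)"
proof -
  define q where "q = real (p ^ k)"
  define n where "n = p div 2"
  have "odd p" using assms(1,2) prime_odd_nat by auto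
  then have n: "p = 2 * n + 1" by (simp add: n_def)
  have char: "CHAR('a) = p" by (rule finite_field_CHAR[OF assms(1,4)])
  have q1: "q \<ge> 1" unfolding q_def using assms(2) by simp
  have nz: "(2::'a) \<noteq> 0" "(3::'a) \<noteq> 0"
    using of_nat_neq_0_CHAR[of 2, where ?'a = 'a] of_nat_neq_0_CHAR[of 3, where ?'a = 'a] char assms(2) by auto
  have sing: "card (- ec_pairs :: ('a \<times> 'a) set) = p ^ k" using card_singular_pairs[OF nz] assms(4) by simp
  have "card (ec_pairs :: ('a \<times> 'a) set) + card (- ec_pairs :: ('a \<times> 'a) set) = CARD('a \<times> 'a)"
    by (subst card_Un_disjoint[symmetric]) (auto simp: Compl_partition)
  then have S: "card (ec_pairs :: ('a \<times> 'a) set) + p ^ k = p ^ (2 * k)"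
    by (simp add: sing assms(4) card_prod mult_2 power_add)
  have 1: "int (card (ec_pairs :: ('a \<times> 'a) set)) = int p ^ (2 * k) - int p ^ k"
    using arg_cong[OF S, of int] by simp
  have S': "real (card (ec_pairs :: ('a \<times> 'a) set)) = q ^ 2 - q"
    using arg_cong[OF S, of real] by (simp add: q_def power_mult[symmetric] mult.commute)
  define c where "c = (p ^ k - 1) div (p - 1)"
  define U where "U = {(A::'a, B). poly (hasse_poly n A) B ^ c = of_nat (nat t)}"
  have U: "\<bar>real (card U) - q ^ 2 / (real p - 1)\<bar> \<le> n * (q * sqrt q) + q"
    unfolding U_def c_def q_def using assms n by (intro hasse_residue_count) auto
  have "[frobenius_trace A B = t] (mod int p) \<longleftrightarrow> (A, B) \<in> U" for A B :: 'a
  proof -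
    have "[frobenius_trace A B = t] (mod int p) \<longleftrightarrow> (of_int (frobenius_trace A B) :: 'a) = of_int t"
      by (simp add: of_int_eq_iff_cong_CHAR char)
    also have "(of_int t :: 'a) = of_nat (nat t)" using assms(5) by simp
    also have "of_int (frobenius_trace A B) = poly (hasse_poly n A) B ^ c"
      unfolding c_def using assms n by (intro frobenius_trace_eq) auto
    finally show ?thesis by (simp add: U_def)
  qed
  then have St: "ec_pairs_trace p t = U \<inter> ec_pairs" by (auto simp: ec_pairs_trace_def)
  have "card U = card (U \<inter> ec_pairs) + card (U - ec_pairs)"
    by (subst card_Un_disjoint[symmetric]) (auto intro: arg_cong[of _ _ card])
  moreover have "card (U - ec_pairs) \<le> card (- ec_pairs :: ('a \<times> 'a) set)" by (intro card_mono) auto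
  ultimately have diff: "\<bar>real (card (ec_pairs_trace p t :: ('a \<times> 'a) set)) - real (card U)\<bar> \<le> q"
    using sing by (simp add: St q_def)
  have "q / (real p - 1) \<le> q" "0 \<le> q / (real p - 1)" using assms(2) q1 by (auto simp: field_simps)
  \<comment> \<open>The three summands q come from the extra q in the estimate for \<open>U\<close>,
    from the singular pairs inside \<open>U\<close>, and from the difference q / (p - 1) between q^2
    / (p - 1) and the main term.\<close>
  then have "\<bar>real (card (ec_pairs_trace p t :: ('a \<times> 'a) set)) - (q ^ 2 - q) / (real p - 1)\<bar> \<le> n * (q * sqrt q) + 3 * q"
    using U diff unfolding diff_divide_distrib by linarith
  also have "\<dots> \<le> n * (q * sqrt q) + 3 * (q * sqrt q)" using q1 by simp
  also have "\<dots> = real (n + 3) * (q * sqrt q)" by (simp add: algebra_simps)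
  also have "\<dots> \<le> real (3 * p) * (q * sqrt q)"
    using q1 n assms(2) by (intro mult_right_mono) auto
  also have "\<dots> = 3 * real p powr (3 * real k / 2 + 1)"
  proof -
    have pp: "real p > 0" using assms(2) by simp
    have "real p powr (3 * real k / 2 + 1) = real p powr real k * (real p powr real k) powr (1 / 2) * real p"
      using pp by (simp add: powr_powr powr_add[symmetric]) (simp add: powr_add)
    also have "real p powr real k = q" using pp by (simp add: powr_realpow q_def)
    finally show ?thesis using q1 by (simp add: powr_half_sqrt)
  qed
  finally show ?thesis using 1 by (simp add: S')
qed

end
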